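(* Let $\mathcal{C}$ be a semi-abelian category such that, for every object $B$ of $\mathcal{C}$, the kernel functor $\mathrm{Ker}_B\colon \mathrm{Pt}_B(\mathcal{C})\to\mathcal{C}$ preserves jointly strongly epimorphic pairs. If $H$ and $K$ are characteristic subobjects of an object $G$ of $\mathcal{C}$, then the join $H \vee K$ is characteristic in $G$.
   Context: For an object $B$ of a pointed category $\mathcal{C}$ with finite limits and finite coproducts, let $\mathrm{Pt}_B(\mathcal{C})$ be the category of points over $B$: objects are split epimorphisms $(A,p,s)$ with $p\colon A\to B$, $s\colon B\to A$, $ps=1_B$; morphisms $(A,p,s)\to(A',p',s')$ are arrows $f\colon A\to A'$ with $p'f=p$, $fs=s'$. The functor $\mathrm{Ker}_B\colon \mathrm{Pt}_B(\mathcal{C})\to\mathcal{C}$, $(A,p,s)\mapsto \mathrm{Ker}(p)$, is right adjoint to $B+(-)$, which sends $X$ to the point $(B+X,[1,0],\iota_B)$. The induced monad on $\mathcal{C}$ is denoted $B\flat(-)$, so that $B\flat X$ is the kernel of $[1,0]\colon B+X\to B$. An (internal) action of $B$ on $X$ is an algebra $\xi\colon B\flat X\to X$ for this monad. A subobject $h\colon H\rightarrowtail G$ is called characteristic in $G$ if for every object $B$ and every action $\xi\colon B\flat G\to G$ there exists a (unique) action $\overline{\xi}\colon B\flat H\to H$ with $h\,\overline{\xi}=\xi\,(1_B\flat h)$. A pair of arrows with common codomain is jointly strongly epimorphic if it does not factor through any proper subobject of the codomain. The join $H\vee K$ is the supremum of $H$ and $K$ in the poset of subobjects of $G$. *)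

theory Defs
  imports Main
begin

section \<open>Categories and functors\<close>

record ('o, 'a) cat =
  Obj :: "'o set"
  Arr :: "'a set"
  Dom :: "'a \<Rightarrow> 'o"
  Cod :: "'a \<Rightarrow> 'o"
  Ident :: "'o \<Rightarrow> 'a"
  Comp :: "'a \<Rightarrow> 'a \<Rightarrow> 'a"  (infixl "\<cdot>\<index>" 55)

definition hom :: "('o, 'a) cat \<Rightarrow> 'o \<Rightarrow> 'o \<Rightarrow> 'a set" where
  "hom C A B = {f \<in> Arr C. Dom C f = A \<and> Cod C f = B}"

locale category =
  fixes C :: "('o, 'a) cat" (structure)
  assumes Dom_in: "f \<in> Arr C \<Longrightarrow> Dom C f \<in> Obj C"
    and Cod_in: "f \<in> Arr C \<Longrightarrow> Cod C f \<in> Obj C"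
    and Ident_in: "A \<in> Obj C \<Longrightarrow> Ident C A \<in> hom C A A"
    and Comp_in: "\<lbrakk>f \<in> hom C A B; g \<in> hom C B D\<rbrakk> \<Longrightarrow> g \<cdot> f \<in> hom C A D"
    and Ident_left: "f \<in> hom C A B \<Longrightarrow> Ident C B \<cdot> f = f"
    and Ident_right: "f \<in> hom C A B \<Longrightarrow> f \<cdot> Ident C A = f"
    and Comp_assoc:
      "\<lbrakk>f \<in> hom C A B; g \<in> hom C B D; k \<in> hom C D E\<rbrakk> \<Longrightarrow> k \<cdot> (g \<cdot> f) = (k \<cdot> g) \<cdot> f"

record ('o, 'a, 'p, 'b) fctr =
  FO :: "'o \<Rightarrow> 'p"
  FA :: "'a \<Rightarrow> 'b"

definition is_functor :: "('o, 'a) cat \<Rightarrow> ('p, 'b) cat \<Rightarrow> ('o, 'a, 'p, 'b) fctr \<Rightarrow> bool" where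
  "is_functor C D F \<longleftrightarrow>
     (\<forall>A\<in>Obj C. FO F A \<in> Obj D \<and> FA F (Ident C A) = Ident D (FO F A)) \<and>
     (\<forall>f\<in>Arr C. FA F f \<in> hom D (FO F (Dom C f)) (FO F (Cod C f))) \<and>
     (\<forall>f\<in>Arr C. \<forall>g\<in>Arr C. Cod C f = Dom C g \<longrightarrow>
        FA F (g \<cdot>\<^bsub>C\<^esub> f) = FA F g \<cdot>\<^bsub>D\<^esub> FA F f)"

definition is_iso :: "('o, 'a) cat \<Rightarrow> 'a \<Rightarrow> bool" where
  "is_iso C f \<longleftrightarrow> f \<in> Arr C \<and>
     (\<exists>g\<in>hom C (Cod C f) (Dom C f).
        g \<cdot>\<^bsub>C\<^esub> f = Ident C (Dom C f) \<and> f \<cdot>\<^bsub>C\<^esub> g = Ident C (Cod C f))"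

definition reflects_isos ::
  "('o, 'a) cat \<Rightarrow> ('p, 'b) cat \<Rightarrow> ('o, 'a, 'p, 'b) fctr \<Rightarrow> bool" where
  "reflects_isos C D F \<longleftrightarrow> (\<forall>f\<in>Arr C. is_iso D (FA F f) \<longrightarrow> is_iso C f)"

section \<open>Subobjects\<close>

definition is_mono :: "('o, 'a) cat \<Rightarrow> 'a \<Rightarrow> bool" where
  "is_mono C m \<longleftrightarrow> m \<in> Arr C \<and>
     (\<forall>u\<in>Arr C. \<forall>v\<in>Arr C. Dom C u = Dom C v \<and> Cod C u = Dom C m \<and> Cod C v = Dom C m \<and>
        m \<cdot>\<^bsub>C\<^esub> u = m \<cdot>\<^bsub>C\<^esub> v \<longrightarrow> u = v)"

text \<open>
  A subobject is represented by a monomorphism into the given object. Two monomorphisms represent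
  the same subobject iff they are below each other in the preorder \<open>sub_le\<close>, so least upper bounds
  for \<open>sub_le\<close> are exactly the representatives of suprema in the poset of subobjects.
\<close>

definition is_subobject :: "('o, 'a) cat \<Rightarrow> 'o \<Rightarrow> 'a \<Rightarrow> bool" where
  "is_subobject C G m \<longleftrightarrow> is_mono C m \<and> Cod C m = G"

definition sub_le :: "('o, 'a) cat \<Rightarrow> 'a \<Rightarrow> 'a \<Rightarrow> bool" where
  "sub_le C m n \<longleftrightarrow> (\<exists>u\<in>hom C (Dom C m) (Dom C n). n \<cdot>\<^bsub>C\<^esub> u = m)"

definition is_join :: "('o, 'a) cat \<Rightarrow> 'o \<Rightarrow> 'a \<Rightarrow> 'a \<Rightarrow> 'a \<Rightarrow> bool" where
  "is_join C G h k j \<longleftrightarrow>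
     is_subobject C G j \<and> sub_le C h j \<and> sub_le C k j \<and>
     (\<forall>n. is_subobject C G n \<and> sub_le C h n \<and> sub_le C k n \<longrightarrow> sub_le C j n)"

definition jointly_strongly_epic :: "('o, 'a) cat \<Rightarrow> 'a \<Rightarrow> 'a \<Rightarrow> bool" where
  "jointly_strongly_epic C f g \<longleftrightarrow>
     f \<in> Arr C \<and> g \<in> Arr C \<and> Cod C f = Cod C g \<and>
     (\<forall>m. is_subobject C (Cod C f) m \<and>
        (\<exists>u\<in>hom C (Dom C f) (Dom C m). m \<cdot>\<^bsub>C\<^esub> u = f) \<and>
        (\<exists>v\<in>hom C (Dom C g) (Dom C m). m \<cdot>\<^bsub>C\<^esub> v = g) \<longrightarrow> is_iso C m)"

definition preserves_jointly_strongly_epic ::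
  "('o, 'a) cat \<Rightarrow> ('p, 'b) cat \<Rightarrow> ('o, 'a, 'p, 'b) fctr \<Rightarrow> bool" where
  "preserves_jointly_strongly_epic C D F \<longleftrightarrow>
     (\<forall>f g. jointly_strongly_epic C f g \<longrightarrow> jointly_strongly_epic D (FA F f) (FA F g))"

section \<open>Limits and colimits\<close>

definition is_cone ::
  "('i, 'j) cat \<Rightarrow> ('o, 'a) cat \<Rightarrow> ('i, 'j, 'o, 'a) fctr \<Rightarrow> 'o \<Rightarrow> ('i \<Rightarrow> 'a) \<Rightarrow> bool" where
  "is_cone J C D L l \<longleftrightarrow>
     L \<in> Obj C \<and> (\<forall>i\<in>Obj J. l i \<in> hom C L (FO D i)) \<and>
     (\<forall>t\<in>Arr J. FA D t \<cdot>\<^bsub>C\<^esub> l (Dom J t) = l (Cod J t))"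

definition is_limit ::
  "('i, 'j) cat \<Rightarrow> ('o, 'a) cat \<Rightarrow> ('i, 'j, 'o, 'a) fctr \<Rightarrow> 'o \<Rightarrow> ('i \<Rightarrow> 'a) \<Rightarrow> bool" where
  "is_limit J C D L l \<longleftrightarrow> is_cone J C D L l \<and>
     (\<forall>M m. is_cone J C D M m \<longrightarrow>
        (\<exists>!w. w \<in> hom C M L \<and> (\<forall>i\<in>Obj J. l i \<cdot>\<^bsub>C\<^esub> w = m i)))"

text \<open>Every finite category is isomorphic to one whose objects and arrows are natural numbers.\<close>

definition has_finite_limits :: "('o, 'a) cat \<Rightarrow> bool" where
  "has_finite_limits C \<longleftrightarrow>
     (\<forall>(J :: (nat, nat) cat) D. category J \<and> finite (Obj J) \<and> finite (Arr J) \<and> is_functor J C D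
        \<longrightarrow> (\<exists>L l. is_limit J C D L l))"

definition is_pullback :: "('o, 'a) cat \<Rightarrow> 'a \<Rightarrow> 'a \<Rightarrow> 'a \<Rightarrow> 'a \<Rightarrow> bool" where
  "is_pullback C p q f g \<longleftrightarrow>
     f \<in> Arr C \<and> g \<in> Arr C \<and> Cod C f = Cod C g \<and>
     p \<in> hom C (Dom C p) (Dom C f) \<and> q \<in> hom C (Dom C p) (Dom C g) \<and>
     f \<cdot>\<^bsub>C\<^esub> p = g \<cdot>\<^bsub>C\<^esub> q \<and>
     (\<forall>T. \<forall>u\<in>hom C T (Dom C f). \<forall>v\<in>hom C T (Dom C g). f \<cdot>\<^bsub>C\<^esub> u = g \<cdot>\<^bsub>C\<^esub> v \<longrightarrow>
        (\<exists>!w. w \<in> hom C T (Dom C p) \<and> p \<cdot>\<^bsub>C\<^esub> w = u \<and> q \<cdot>\<^bsub>C\<^esub> w = v))"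

definition pb :: "('o, 'a) cat \<Rightarrow> 'a \<Rightarrow> 'a \<Rightarrow> 'a \<times> 'a" where
  "pb C f g = (SOME (p, q). is_pullback C p q f g)"

definition is_coequalizer :: "('o, 'a) cat \<Rightarrow> 'a \<Rightarrow> 'a \<Rightarrow> 'a \<Rightarrow> bool" where
  "is_coequalizer C e f g \<longleftrightarrow>
     f \<in> Arr C \<and> g \<in> hom C (Dom C f) (Cod C f) \<and> e \<in> hom C (Cod C f) (Cod C e) \<and>
     e \<cdot>\<^bsub>C\<^esub> f = e \<cdot>\<^bsub>C\<^esub> g \<and>
     (\<forall>T. \<forall>u\<in>hom C (Cod C f) T. u \<cdot>\<^bsub>C\<^esub> f = u \<cdot>\<^bsub>C\<^esub> g \<longrightarrow>
        (\<exists>!w. w \<in> hom C (Cod C e) T \<and> w \<cdot>\<^bsub>C\<^esub> e = u))"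

definition is_coproduct :: "('o, 'a) cat \<Rightarrow> 'o \<Rightarrow> 'o \<Rightarrow> 'a \<Rightarrow> 'a \<Rightarrow> bool" where
  "is_coproduct C A B i j \<longleftrightarrow>
     i \<in> hom C A (Cod C i) \<and> j \<in> hom C B (Cod C i) \<and>
     (\<forall>T. \<forall>u\<in>hom C A T. \<forall>v\<in>hom C B T.
        (\<exists>!w. w \<in> hom C (Cod C i) T \<and> w \<cdot>\<^bsub>C\<^esub> i = u \<and> w \<cdot>\<^bsub>C\<^esub> j = v))"

definition has_binary_coproducts :: "('o, 'a) cat \<Rightarrow> bool" where
  "has_binary_coproducts C \<longleftrightarrow> (\<forall>A\<in>Obj C. \<forall>B\<in>Obj C. \<exists>i j. is_coproduct C A B i j)"

definition coprod :: "('o, 'a) cat \<Rightarrow> 'o \<Rightarrow> 'o \<Rightarrow> 'a \<times> 'a" where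
  "coprod C A B = (SOME (i, j). is_coproduct C A B i j)"

definition inl :: "('o, 'a) cat \<Rightarrow> 'o \<Rightarrow> 'o \<Rightarrow> 'a" where
  "inl C A B = fst (coprod C A B)"

definition inr :: "('o, 'a) cat \<Rightarrow> 'o \<Rightarrow> 'o \<Rightarrow> 'a" where
  "inr C A B = snd (coprod C A B)"

definition coprod_obj :: "('o, 'a) cat \<Rightarrow> 'o \<Rightarrow> 'o \<Rightarrow> 'o" where
  "coprod_obj C A B = Cod C (inl C A B)"

definition copair :: "('o, 'a) cat \<Rightarrow> 'a \<Rightarrow> 'a \<Rightarrow> 'a" where
  "copair C f g =
     (THE w. w \<in> hom C (coprod_obj C (Dom C f) (Dom C g)) (Cod C f) \<and>
        w \<cdot>\<^bsub>C\<^esub> inl C (Dom C f) (Dom C g) = f \<and> w \<cdot>\<^bsub>C\<^esub> inr C (Dom C f) (Dom C g) = g)"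

definition is_zero :: "('o, 'a) cat \<Rightarrow> 'o \<Rightarrow> bool" where
  "is_zero C Z \<longleftrightarrow> Z \<in> Obj C \<and>
     (\<forall>A\<in>Obj C. (\<exists>!f. f \<in> hom C A Z) \<and> (\<exists>!f. f \<in> hom C Z A))"

definition pointed :: "('o, 'a) cat \<Rightarrow> bool" where
  "pointed C \<longleftrightarrow> (\<exists>Z. is_zero C Z)"

definition zero_arr :: "('o, 'a) cat \<Rightarrow> 'o \<Rightarrow> 'o \<Rightarrow> 'a" where
  "zero_arr C A B =
     (THE f. \<exists>Z u v. is_zero C Z \<and> u \<in> hom C A Z \<and> v \<in> hom C Z B \<and> f = v \<cdot>\<^bsub>C\<^esub> u)"

definition is_kernel :: "('o, 'a) cat \<Rightarrow> 'a \<Rightarrow> 'a \<Rightarrow> bool" where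
  "is_kernel C k f \<longleftrightarrow>
     f \<in> Arr C \<and> k \<in> hom C (Dom C k) (Dom C f) \<and>
     f \<cdot>\<^bsub>C\<^esub> k = zero_arr C (Dom C k) (Cod C f) \<and>
     (\<forall>T. \<forall>u\<in>hom C T (Dom C f). f \<cdot>\<^bsub>C\<^esub> u = zero_arr C T (Cod C f) \<longrightarrow>
        (\<exists>!w. w \<in> hom C T (Dom C k) \<and> k \<cdot>\<^bsub>C\<^esub> w = u))"

definition ker :: "('o, 'a) cat \<Rightarrow> 'a \<Rightarrow> 'a" where
  "ker C f = (SOME k. is_kernel C k f)"

definition ker_obj :: "('o, 'a) cat \<Rightarrow> 'a \<Rightarrow> 'o" where
  "ker_obj C f = Dom C (ker C f)"

section \<open>The category of points\<close>

type_synonym ('o, 'a) point = "'o \<times> 'a \<times> 'a"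

definition points :: "('o, 'a) cat \<Rightarrow> 'o \<Rightarrow> ('o, 'a) point set" where
  "points C B = {(A, p, s). p \<in> hom C A B \<and> s \<in> hom C B A \<and> p \<cdot>\<^bsub>C\<^esub> s = Ident C B}"

text \<open>
  An arrow of points is stored together with its domain and its codomain, since the same arrow
  of the base category may underlie several arrows of points.
\<close>

definition Pt ::
  "('o, 'a) cat \<Rightarrow> 'o \<Rightarrow> (('o, 'a) point, ('o, 'a) point \<times> 'a \<times> ('o, 'a) point) cat" where
  "Pt C B =
     \<lparr> Obj = points C B,
       Arr = {((A, p, s), f, (A', p', s')) | A p s f A' p' s'.
                (A, p, s) \<in> points C B \<and> (A', p', s') \<in> points C B \<and>
                f \<in> hom C A A' \<and> p' \<cdot>\<^bsub>C\<^esub> f = p \<and> f \<cdot>\<^bsub>C\<^esub> s = s'},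
       Dom = (\<lambda>(X, f, Y). X),
       Cod = (\<lambda>(X, f, Y). Y),
       Ident = (\<lambda>X. (X, Ident C (fst X), X)),
       Comp = (\<lambda>(Y, g, Z) (X, f, Y'). (X, g \<cdot>\<^bsub>C\<^esub> f, Z)) \<rparr>"

text \<open>Pulling back along \<open>v\<close> from \<open>E\<close> to \<open>B\<close> is a functor from \<open>Pt C B\<close> to \<open>Pt C E\<close>.\<close>

definition base_change_point :: "('o, 'a) cat \<Rightarrow> 'a \<Rightarrow> ('o, 'a) point \<Rightarrow> ('o, 'a) point" where
  "base_change_point C v = (\<lambda>(A, p, s).
     let (q, r) = pb C v p in
       (Dom C q, q,
        THE t. t \<in> hom C (Dom C v) (Dom C q) \<and>
          q \<cdot>\<^bsub>C\<^esub> t = Ident C (Dom C v) \<and> r \<cdot>\<^bsub>C\<^esub> t = s \<cdot>\<^bsub>C\<^esub> v))"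

definition base_change ::
  "('o, 'a) cat \<Rightarrow> 'a \<Rightarrow>
     (('o, 'a) point, ('o, 'a) point \<times> 'a \<times> ('o, 'a) point,
      ('o, 'a) point, ('o, 'a) point \<times> 'a \<times> ('o, 'a) point) fctr" where
  "base_change C v =
     \<lparr> FO = base_change_point C v,
       FA = (\<lambda>((A, p, s), f, (A', p', s')).
         let (q, r) = pb C v p; (q', r') = pb C v p' in
           (base_change_point C v (A, p, s),
            THE w. w \<in> hom C (Dom C q) (Dom C q') \<and>
              q' \<cdot>\<^bsub>C\<^esub> w = q \<and> r' \<cdot>\<^bsub>C\<^esub> w = f \<cdot>\<^bsub>C\<^esub> r,
            base_change_point C v (A', p', s'))) \<rparr>"

section \<open>Semi-abelian categories\<close>

definition is_regular_epi :: "('o, 'a) cat \<Rightarrow> 'a \<Rightarrow> bool" where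
  "is_regular_epi C e \<longleftrightarrow> (\<exists>f g. is_coequalizer C e f g)"

definition regular :: "('o, 'a) cat \<Rightarrow> bool" where
  "regular C \<longleftrightarrow> has_finite_limits C \<and>
     (\<forall>f p q. is_pullback C p q f f \<longrightarrow> (\<exists>e. is_coequalizer C e p q)) \<and>
     (\<forall>f e p q. is_regular_epi C e \<and> is_pullback C p q f e \<longrightarrow> is_regular_epi C p)"

definition is_equivalence_relation :: "('o, 'a) cat \<Rightarrow> 'o \<Rightarrow> 'a \<Rightarrow> 'a \<Rightarrow> bool" where
  "is_equivalence_relation C X r r' \<longleftrightarrow>
     (let R = Dom C r in
       r \<in> hom C R X \<and> r' \<in> hom C R X \<and>
       (\<forall>T. \<forall>u\<in>hom C T R. \<forall>v\<in>hom C T R.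
          r \<cdot>\<^bsub>C\<^esub> u = r \<cdot>\<^bsub>C\<^esub> v \<and> r' \<cdot>\<^bsub>C\<^esub> u = r' \<cdot>\<^bsub>C\<^esub> v \<longrightarrow> u = v) \<and>
       (\<exists>d\<in>hom C X R. r \<cdot>\<^bsub>C\<^esub> d = Ident C X \<and> r' \<cdot>\<^bsub>C\<^esub> d = Ident C X) \<and>
       (\<exists>c\<in>hom C R R. r \<cdot>\<^bsub>C\<^esub> c = r' \<and> r' \<cdot>\<^bsub>C\<^esub> c = r) \<and>
       (\<forall>p q. is_pullback C p q r' r \<longrightarrow>
          (\<exists>t\<in>hom C (Dom C p) R. r \<cdot>\<^bsub>C\<^esub> t = r \<cdot>\<^bsub>C\<^esub> p \<and> r' \<cdot>\<^bsub>C\<^esub> t = r' \<cdot>\<^bsub>C\<^esub> q)))"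

definition barr_exact :: "('o, 'a) cat \<Rightarrow> bool" where
  "barr_exact C \<longleftrightarrow> regular C \<and>
     (\<forall>X r r'. is_equivalence_relation C X r r' \<longrightarrow> (\<exists>f. is_pullback C r r' f f))"

definition protomodular :: "('o, 'a) cat \<Rightarrow> bool" where
  "protomodular C \<longleftrightarrow>
     (\<forall>v\<in>Arr C. reflects_isos (Pt C (Cod C v)) (Pt C (Dom C v)) (base_change C v))"

text \<open>
  Janelidze, Marki and Tholen. Binary coproducts suffice for finite ones, since a zero object
  is initial.
\<close>

definition semi_abelian :: "('o, 'a) cat \<Rightarrow> bool" where
  "semi_abelian C \<longleftrightarrow>
     category C \<and> pointed C \<and> has_binary_coproducts C \<and> barr_exact C \<and> protomodular C"

section \<open>Monads, algebras and internal actions\<close>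

record ('o, 'a) mnd =
  Endo :: "('o, 'a, 'o, 'a) fctr"
  Unit :: "'o \<Rightarrow> 'a"
  Mult :: "'o \<Rightarrow> 'a"

definition is_algebra :: "('o, 'a) cat \<Rightarrow> ('o, 'a) mnd \<Rightarrow> 'o \<Rightarrow> 'a \<Rightarrow> bool" where
  "is_algebra C M X a \<longleftrightarrow>
     X \<in> Obj C \<and> a \<in> hom C (FO (Endo M) X) X \<and>
     a \<cdot>\<^bsub>C\<^esub> Unit M X = Ident C X \<and>
     a \<cdot>\<^bsub>C\<^esub> Mult M X = a \<cdot>\<^bsub>C\<^esub> FA (Endo M) a"

definition adjunction_monad ::
  "('o, 'a, 'p, 'b) fctr \<Rightarrow> ('p, 'b, 'o, 'a) fctr \<Rightarrow> ('o \<Rightarrow> 'a) \<Rightarrow> ('p \<Rightarrow> 'b) \<Rightarrow> ('o, 'a) mnd" where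
  "adjunction_monad F U \<eta> \<epsilon> =
     \<lparr> Endo = \<lparr> FO = (\<lambda>X. FO U (FO F X)), FA = (\<lambda>f. FA U (FA F f)) \<rparr>,
       Unit = \<eta>,
       Mult = (\<lambda>X. FA U (\<epsilon> (FO F X))) \<rparr>"

definition ker_functor ::
  "('o, 'a) cat \<Rightarrow> 'o \<Rightarrow>
     (('o, 'a) point, ('o, 'a) point \<times> 'a \<times> ('o, 'a) point, 'o, 'a) fctr" where
  "ker_functor C B =
     \<lparr> FO = (\<lambda>(A, p, s). ker_obj C p),
       FA = (\<lambda>((A, p, s), f, (A', p', s')).
         THE w. w \<in> hom C (ker_obj C p) (ker_obj C p') \<and>
           ker C p' \<cdot>\<^bsub>C\<^esub> w = f \<cdot>\<^bsub>C\<^esub> ker C p) \<rparr>"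

definition plus_point :: "('o, 'a) cat \<Rightarrow> 'o \<Rightarrow> 'o \<Rightarrow> ('o, 'a) point" where
  "plus_point C B X =
     (coprod_obj C B X, copair C (Ident C B) (zero_arr C X B), inl C B X)"

definition plus_functor ::
  "('o, 'a) cat \<Rightarrow> 'o \<Rightarrow>
     ('o, 'a, ('o, 'a) point, ('o, 'a) point \<times> 'a \<times> ('o, 'a) point) fctr" where
  "plus_functor C B =
     \<lparr> FO = plus_point C B,
       FA = (\<lambda>f. (plus_point C B (Dom C f),
                  copair C (inl C B (Cod C f)) (inr C B (Cod C f) \<cdot>\<^bsub>C\<^esub> f),
                  plus_point C B (Cod C f))) \<rparr>"

text \<open>
  Unit and counit of the adjunction between \<open>plus_functor C B\<close> (left adjoint) and
  \<open>ker_functor C B\<close>: the unit at \<open>X\<close> is the factorization of the coproduct injection of \<open>X\<close> through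
  the kernel of \<open>[1, 0]\<close>, and the counit at \<open>(A, p, s)\<close> is \<open>[s, ker p]\<close>.
\<close>

definition plus_ker_unit :: "('o, 'a) cat \<Rightarrow> 'o \<Rightarrow> 'o \<Rightarrow> 'a" where
  "plus_ker_unit C B X =
     (let k = ker C (copair C (Ident C B) (zero_arr C X B)) in
       THE w. w \<in> hom C X (Dom C k) \<and> k \<cdot>\<^bsub>C\<^esub> w = inr C B X)"

definition plus_ker_counit ::
  "('o, 'a) cat \<Rightarrow> 'o \<Rightarrow> ('o, 'a) point \<Rightarrow> ('o, 'a) point \<times> 'a \<times> ('o, 'a) point" where
  "plus_ker_counit C B = (\<lambda>(A, p, s).
     (plus_point C B (ker_obj C p), copair C s (ker C p), (A, p, s)))"

definition flat_monad :: "('o, 'a) cat \<Rightarrow> 'o \<Rightarrow> ('o, 'a) mnd" where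
  "flat_monad C B =
     adjunction_monad (plus_functor C B) (ker_functor C B)
       (plus_ker_unit C B) (plus_ker_counit C B)"

definition is_action :: "('o, 'a) cat \<Rightarrow> 'o \<Rightarrow> 'o \<Rightarrow> 'a \<Rightarrow> bool" where
  "is_action C B X a \<longleftrightarrow> is_algebra C (flat_monad C B) X a"

definition is_characteristic :: "('o, 'a) cat \<Rightarrow> 'o \<Rightarrow> 'a \<Rightarrow> bool" where
  "is_characteristic C G h \<longleftrightarrow> is_subobject C G h \<and>
     (\<forall>B\<in>Obj C. \<forall>a. is_action C B G a \<longrightarrow>
        (\<exists>!b. is_action C B (Dom C h) b \<and>
           h \<cdot>\<^bsub>C\<^esub> b = a \<cdot>\<^bsub>C\<^esub> FA (Endo (flat_monad C B)) h))"

end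

(*
  Write T for the monad of B-actions and let u, v include H and K in J = H \<or> K. The pair (u, v) is
  jointly strongly epic, because a subobject of J containing H and K is an upper bound of H and K
  in G. The left adjoint B + (-) preserves such pairs: pulling back along the unit of the
  adjunction shows that any subobject in Pt_B containing both images is split epic. The hypothesis
  on Ker_B therefore makes (T u, T v) jointly strongly epic. For an action \<xi> on G, the arrow
  \<xi> (T j) restricted along T u and T v lands in H and K, so the pullback of j along \<xi> (T j) is an
  isomorphism; hence \<xi> (T j) factors through j. The factorization is an action because j is monic.
  The join itself is the image of [h, k].
*)
theory Submission
  imports Defs
begin

section \<open>Arrows, monomorphisms and pullbacks\<close>

text \<open>The monad is the composite of two functors of unequal behaviour. A left adjoint always
  preserves jointly strongly epic pairs, whereas its right adjoint may fail to do so, which is why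
  the hypothesis concerns \<open>Ker_B\<close> alone. The test subobjects for \<open>B + (-)\<close>
  live in the category of points, but no limits are constructed there. A right adjoint preserves
  monomorphisms, so a subobject \<open>m\<close> of \<open>F J\<close> yields the subobject
  \<open>U m\<close> of \<open>U F J\<close>, and the pullback along the unit
  \<open>J -> U F J\<close> is formed in the base category. Transposing the resulting lift of the
  unit gives a section of \<open>m\<close> by a triangle identity. None of this refers to points, so
  it is proved for the monad of an arbitrary adjunction. What remains is to show that coproducts and
  kernels form such an adjunction; since kernels, injections, copairings and zero arrows are given
  by description operators, each must first be shown to have its universal property. Existence of
  the join is a separate matter: images come from coequalizers of kernel pairs, and pullback
  stability of regular epimorphisms makes the second factor monic.\<close>

lemma hom_iff: "f \<in> hom C A B \<longleftrightarrow> f \<in> Arr C \<and> Dom C f = A \<and> Cod C f = B"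
  by (simp add: hom_def)

context category
begin

lemma comp_arr [simp]:
  assumes "f \<in> Arr C" "g \<in> Arr C" "Cod C f = Dom C g"
  shows "g \<cdot> f \<in> Arr C" "Dom C (g \<cdot> f) = Dom C f" "Cod C (g \<cdot> f) = Cod C g"
  using Comp_in[of f "Dom C f" "Cod C f" g "Cod C g"] assms by (auto simp: hom_iff)

text \<open>The axiom \<open>Comp_assoc\<close> has intermediate objects in its premises that its
  equation does not determine. With premises on \<open>Dom\<close> and \<open>Cod\<close> the
  simplifier can discharge them, and composites are normalized to right-nested form.\<close>

lemma comp_assoc [simp]:
  assumes "f \<in> Arr C" "g \<in> Arr C" "e \<in> Arr C" "Cod C f = Dom C g" "Cod C g = Dom C e"
  shows "(e \<cdot> g) \<cdot> f = e \<cdot> (g \<cdot> f)"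
  using Comp_assoc[of f "Dom C f" "Cod C f" g "Cod C g" e "Cod C e"] assms
  by (simp add: hom_iff)

lemma ident_arr [simp]:
  assumes "A \<in> Obj C"
  shows "Ident C A \<in> Arr C" "Dom C (Ident C A) = A" "Cod C (Ident C A) = A"
  using Ident_in[OF assms] by (auto simp: hom_iff)

lemma comp_ident [simp]:
  assumes "f \<in> Arr C"
  shows "Cod C f = A \<Longrightarrow> Ident C A \<cdot> f = f" "Dom C f = A \<Longrightarrow> f \<cdot> Ident C A = f"
  using Ident_left[of f "Dom C f" "Cod C f"] Ident_right[of f "Dom C f" "Cod C f"] assms
  by (auto simp: hom_iff)

lemma hom_obj:
  assumes "f \<in> hom C A B"
  shows "A \<in> Obj C" "B \<in> Obj C"
  using Dom_in[of f] Cod_in[of f] assms by (auto simp: hom_iff)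

declare Dom_in [simp] Cod_in [simp]

text \<open>In right-nested normal form a commutative square no longer occurs as a subterm once
  another arrow is composed on the right; this rule reapplies the square there.\<close>

lemma comp_eq_extend:
  assumes "g \<cdot> f = g' \<cdot> f'" "Cod C x = Dom C f" "Dom C f = Dom C f'"
    "x \<in> Arr C" "f \<in> Arr C" "f' \<in> Arr C" "g \<in> Arr C" "g' \<in> Arr C"
    "Cod C f = Dom C g" "Cod C f' = Dom C g'"
  shows "g \<cdot> (f \<cdot> x) = g' \<cdot> (f' \<cdot> x)"
  using assms by (metis comp_assoc)

lemma mono_cancel:
  assumes "is_mono C m" "m \<cdot> u = m \<cdot> v" "u \<in> hom C T (Dom C m)" "v \<in> hom C T (Dom C m)"
  shows "u = v"
  using assms by (auto simp: is_mono_def hom_iff)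

lemma mono_comp:
  assumes m: "is_mono C m" and n: "is_mono C n" and eq: "Cod C n = Dom C m"
  shows "is_mono C (m \<cdot> n)"
proof -
  have arr: "m \<in> Arr C" "n \<in> Arr C" using m n by (auto simp: is_mono_def)
  show ?thesis
    unfolding is_mono_def
  proof (intro conjI ballI impI; (elim conjE)?)
    show "m \<cdot> n \<in> Arr C" using arr eq by simp
    fix u v
    assume uv: "u \<in> Arr C" "v \<in> Arr C" "Dom C u = Dom C v" "Cod C u = Dom C (m \<cdot> n)"
      "Cod C v = Dom C (m \<cdot> n)" "(m \<cdot> n) \<cdot> u = (m \<cdot> n) \<cdot> v"
    have "n \<cdot> u = n \<cdot> v"
      using uv arr eq by - (rule mono_cancel[OF m, of _ _ "Dom C u"]; auto simp: hom_iff)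
    then show "u = v"
      using uv arr eq by - (rule mono_cancel[OF n, of _ _ "Dom C u"]; auto simp: hom_iff)
  qed
qed

text \<open>Since \<open>m (t m) = (m t) m = m\<close>, cancelling \<open>m\<close> shows that the
  section \<open>t\<close> is also a left inverse.\<close>

lemma mono_split_iso:
  assumes m: "is_mono C m" and t: "t \<in> hom C (Cod C m) (Dom C m)"
    and mt: "m \<cdot> t = Ident C (Cod C m)"
  shows "is_iso C m"
proof -
  have arr: "m \<in> Arr C" using m by (simp add: is_mono_def)
  have "m \<cdot> (t \<cdot> m) = (m \<cdot> t) \<cdot> m"
    using arr t by (simp add: hom_iff)
  also have "\<dots> = m \<cdot> Ident C (Dom C m)" using arr mt by simp
  finally have "t \<cdot> m = Ident C (Dom C m)"
    using arr t by - (rule mono_cancel[OF m]; auto simp: hom_iff)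
  then show ?thesis using arr t mt by (auto simp: is_iso_def)
qed

lemma pullback_factor:
  assumes "is_pullback C p q f g" "u \<in> hom C T (Dom C f)" "v \<in> hom C T (Dom C g)"
    "f \<cdot> u = g \<cdot> v"
  obtains w where "w \<in> hom C T (Dom C p)" "p \<cdot> w = u" "q \<cdot> w = v"
  using assms unfolding is_pullback_def by blast

lemma coequalizer_factor:
  assumes "is_coequalizer C e f g" "u \<in> hom C (Cod C f) T" "u \<cdot> f = u \<cdot> g"
  obtains w where "w \<in> hom C (Cod C e) T" "w \<cdot> e = u"
  using assms unfolding is_coequalizer_def by blast

lemma coproduct_factor:
  assumes "is_coproduct C A B i j" "u \<in> hom C A T" "v \<in> hom C B T"
  obtains w where "w \<in> hom C (Cod C i) T" "w \<cdot> i = u" "w \<cdot> j = v"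
  using assms unfolding is_coproduct_def by blast

lemma coproduct_cancel:
  assumes c: "is_coproduct C A B i j" and w: "w \<in> hom C (Cod C i) T" "w' \<in> hom C (Cod C i) T"
    and eq: "w \<cdot> i = w' \<cdot> i" "w \<cdot> j = w' \<cdot> j"
  shows "w = w'"
proof -
  have ij: "i \<in> hom C A (Cod C i)" "j \<in> hom C B (Cod C i)"
    using c by (auto simp: is_coproduct_def)
  have "w \<cdot> i \<in> hom C A T" "w \<cdot> j \<in> hom C B T"
    using Comp_in[OF ij(1) w(1)] Comp_in[OF ij(2) w(1)] by auto
  then have "\<exists>!x. x \<in> hom C (Cod C i) T \<and> x \<cdot> i = w \<cdot> i \<and> x \<cdot> j = w \<cdot> j"
    using c unfolding is_coproduct_def by blast
  then show ?thesis using w eq by metis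
qed

text \<open>If \<open>p u = p v\<close>, then \<open>m q u = f p u = f p v = m q v\<close>, so the
  monic \<open>m\<close> forces \<open>q u = q v\<close>, and uniqueness in the pullback gives
  \<open>u = v\<close>.\<close>

lemma pullback_mono:
  assumes pb: "is_pullback C p q f m" and m: "is_mono C m"
  shows "is_mono C p"
proof -
  have arr: "p \<in> Arr C" "q \<in> Arr C" "f \<in> Arr C" "m \<in> Arr C" "Cod C f = Cod C m"
    "Cod C p = Dom C f" "Cod C q = Dom C m" "Dom C q = Dom C p" "f \<cdot> p = m \<cdot> q"
    using pb by (auto simp: is_pullback_def hom_iff)
  show ?thesis
    unfolding is_mono_def
  proof (intro conjI ballI impI; (elim conjE)?)
    show "p \<in> Arr C" by (fact arr)
    fix u v
    assume uv: "u \<in> Arr C" "v \<in> Arr C" "Dom C u = Dom C v" "Cod C u = Dom C p"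
      "Cod C v = Dom C p" "p \<cdot> u = p \<cdot> v"
    have sq: "m \<cdot> (q \<cdot> x) = f \<cdot> (p \<cdot> x)" if "x \<in> Arr C" "Cod C x = Dom C p" for x
      using that arr by - (rule comp_eq_extend; auto)
    have q: "q \<cdot> u = q \<cdot> v"
      using uv arr by - (rule mono_cancel[OF m, of _ _ "Dom C u"]; auto simp: hom_iff sq)
    have "\<exists>!w. w \<in> hom C (Dom C u) (Dom C p) \<and> p \<cdot> w = p \<cdot> u \<and> q \<cdot> w = q \<cdot> u"
      using pb uv arr sq unfolding is_pullback_def by (simp add: hom_iff)
    then show "u = v" using uv q by (auto simp: hom_iff)
  qed
qed

lemma join_jointly_strongly_epic:
  assumes j: "is_join C G h k j"
    and u: "u \<in> hom C (Dom C h) (Dom C j)" "j \<cdot> u = h"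
    and v: "v \<in> hom C (Dom C k) (Dom C j)" "j \<cdot> v = k"
  shows "jointly_strongly_epic C u v"
proof -
  have jm: "is_mono C j" and jG: "Cod C j = G" and ja: "j \<in> Arr C"
    using j by (auto simp: is_join_def is_subobject_def is_mono_def)
  have "is_iso C m"
    if m: "is_subobject C (Cod C u) m" and a: "a \<in> hom C (Dom C u) (Dom C m)" "m \<cdot> a = u"
      and b: "b \<in> hom C (Dom C v) (Dom C m)" "m \<cdot> b = v" for m a b
  proof -
    have mm: "is_mono C m" and mj: "m \<in> Arr C" "Cod C m = Dom C j"
      using m u by (auto simp: is_subobject_def hom_iff is_mono_def)
    have "is_subobject C G (j \<cdot> m)"
      using mono_comp[OF jm mm] mj ja jG by (simp add: is_subobject_def)
    moreover have "sub_le C h (j \<cdot> m)"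
      unfolding sub_le_def using a u mj ja by (intro bexI[of _ a]) (auto simp: hom_iff)
    moreover have "sub_le C k (j \<cdot> m)"
      unfolding sub_le_def using b v mj ja by (intro bexI[of _ b]) (auto simp: hom_iff)
    ultimately have "sub_le C j (j \<cdot> m)" using j by (auto simp: is_join_def)
    then obtain t where t: "t \<in> hom C (Dom C j) (Dom C (j \<cdot> m))" "(j \<cdot> m) \<cdot> t = j"
      unfolding sub_le_def by blast
    \<comment> \<open>Minimality of the join places \<open>j\<close> below
      \<open>j \<cdot> m\<close>; cancelling the monic \<open>j\<close> turns this comparison into a
      section of \<open>m\<close>.\<close>
    have "j \<cdot> (m \<cdot> t) = j" using t mj ja by (simp add: hom_iff)
    then have "m \<cdot> t = Ident C (Dom C j)"
      using t(1) mj ja by - (rule mono_cancel[OF jm, of _ _ "Dom C j"]; auto simp: hom_iff)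
    then show ?thesis using mono_split_iso[OF mm] t(1) mj ja by simp
  qed
  then show ?thesis
    unfolding jointly_strongly_epic_def using u v by (auto simp: hom_iff)
qed

end

section \<open>Pullbacks from finite limits\<close>

locale finitely_complete_category = category +
  assumes finite_limits: "has_finite_limits C"

text \<open>The walking cospan: \<open>0\<close>, \<open>1\<close>, \<open>2\<close> are the objects and their identities, while
  \<open>3\<close> goes from \<open>0\<close> to \<open>2\<close> and \<open>4\<close> from \<open>1\<close> to \<open>2\<close>.\<close>

definition cospan_shape :: "(nat, nat) cat" where
  "cospan_shape =
     \<lparr> Obj = {0, 1, 2}, Arr = {0, 1, 2, 3, 4},
       Dom = (\<lambda>t. if t = 3 then 0 else if t = 4 then 1 else t),
       Cod = (\<lambda>t. if t = 3 \<or> t = 4 then 2 else t),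
       Ident = (\<lambda>i. i),
       Comp = (\<lambda>t s. if s < 3 then t else s) \<rparr>"

text \<open>The composition rule is correct on composable pairs: an inner arrow below
  \<open>3\<close> is an identity, so the outer one is returned; an inner arrow \<open>3\<close> or
  \<open>4\<close> ends at \<open>2\<close>, where only the identity starts.\<close>

lemma category_cospan_shape: "category cospan_shape"
  by unfold_locales (auto simp: cospan_shape_def hom_def)

definition cospan_diagram ::
  "('o, 'a) cat \<Rightarrow> 'a \<Rightarrow> 'a \<Rightarrow> (nat, nat, 'o, 'a) fctr" where
  "cospan_diagram C f g =
     \<lparr> FO = (\<lambda>i. if i = 0 then Dom C f else if i = 1 then Dom C g else Cod C f),
       FA = (\<lambda>t. if t = 0 then Ident C (Dom C f) else if t = 1 then Ident C (Dom C g)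
                 else if t = 2 then Ident C (Cod C f) else if t = 3 then f else g) \<rparr>"

context finitely_complete_category
begin

lemma pullback_exists:
  assumes f: "f \<in> Arr C" and g: "g \<in> Arr C" and fg: "Cod C f = Cod C g"
  obtains p q where "is_pullback C p q f g"
proof -
  let ?D = "cospan_diagram C f g"
  have D: "is_functor cospan_shape C ?D"
    using f g fg unfolding is_functor_def
    by (auto simp: cospan_shape_def cospan_diagram_def hom_iff)
  \<comment> \<open>The leg at \<open>2\<close> is determined by either of the others, so a cone is
    just a commutative square over the cospan.\<close>
  have cone: "is_cone cospan_shape C ?D L l \<longleftrightarrow>
      l 0 \<in> hom C L (Dom C f) \<and> l 1 \<in> hom C L (Dom C g) \<and>
      f \<cdot> l 0 = l 2 \<and> g \<cdot> l 1 = l 2" for L l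
  proof -
    have "l 2 \<in> hom C L (Cod C f)" if "l 0 \<in> hom C L (Dom C f)" "f \<cdot> l 0 = l 2"
      using that f by (auto simp: hom_iff simp flip: that(2))
    then show ?thesis
      using f g fg hom_obj[of "l 0" L "Dom C f"] unfolding is_cone_def
      by (auto simp: cospan_shape_def cospan_diagram_def hom_iff)
  qed
  obtain L l where lim: "is_limit cospan_shape C ?D L l"
    using finite_limits D category_cospan_shape unfolding has_finite_limits_def
    by (fastforce simp: cospan_shape_def)
  have L: "l 0 \<in> hom C L (Dom C f)" "l 1 \<in> hom C L (Dom C g)" "f \<cdot> l 0 = l 2" "g \<cdot> l 1 = l 2"
    using lim by (auto simp: is_limit_def cone)
  have univ: "\<exists>!w. w \<in> hom C T (Dom C (l 0)) \<and> l 0 \<cdot> w = u \<and> l 1 \<cdot> w = v"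
    if u: "u \<in> hom C T (Dom C f)" and v: "v \<in> hom C T (Dom C g)" and uv: "f \<cdot> u = g \<cdot> v" for T u v
  proof -
    let ?m = "\<lambda>i::nat. if i = 0 then u else if i = 1 then v else f \<cdot> u"
    have "is_cone cospan_shape C ?D T ?m" using u v uv by (auto simp: cone)
    then have "\<exists>!w. w \<in> hom C T L \<and> (\<forall>i\<in>Obj cospan_shape. l i \<cdot> w = ?m i)"
      using lim by (auto simp: is_limit_def)
    moreover have "(\<forall>i\<in>Obj cospan_shape. l i \<cdot> w = ?m i) \<longleftrightarrow> l 0 \<cdot> w = u \<and> l 1 \<cdot> w = v"
      if "w \<in> hom C T L" for w
    proof -
      have "l 2 \<cdot> w = f \<cdot> (l 0 \<cdot> w)"
        using that L(1) f by (simp add: L(3)[symmetric] hom_iff)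
      then show ?thesis by (auto simp: cospan_shape_def)
    qed
    moreover have "Dom C (l 0) = L" using L by (simp add: hom_iff)
    ultimately show ?thesis by (metis (no_types, lifting))
  qed
  have "is_pullback C (l 0) (l 1) f g"
    unfolding is_pullback_def
  proof (intro conjI allI ballI impI)
    fix T u v
    assume "u \<in> hom C T (Dom C f)" "v \<in> hom C T (Dom C g)" "f \<cdot> u = g \<cdot> v"
    then show "\<exists>!w. w \<in> hom C T (Dom C (l 0)) \<and> l 0 \<cdot> w = u \<and> l 1 \<cdot> w = v"
      by (rule univ)
  qed (use L f g fg in \<open>simp_all add: hom_iff\<close>)
  then show thesis by (rule that)
qed

text \<open>Orthogonality to monomorphisms: the pullback of \<open>m\<close> along \<open>f\<close>
  is a subobject through which both \<open>u\<close> and \<open>v\<close> factor, hence an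
  isomorphism, and its inverse followed by the other projection is the lift. It is applied once to
  the unit of the adjunction and once to an action restricted to the join.\<close>

lemma jointly_strongly_epic_factor:
  assumes uv: "jointly_strongly_epic C u v" and m: "is_mono C m"
    and f: "f \<in> hom C (Cod C u) (Cod C m)"
    and a: "a \<in> hom C (Dom C u) (Dom C m)" "f \<cdot> u = m \<cdot> a"
    and b: "b \<in> hom C (Dom C v) (Dom C m)" "f \<cdot> v = m \<cdot> b"
  obtains r where "r \<in> hom C (Cod C u) (Dom C m)" "m \<cdot> r = f"
proof -
  have ma: "m \<in> Arr C" using m by (simp add: is_mono_def)
  have uva: "u \<in> Arr C" "v \<in> Arr C" "Cod C v = Cod C u"
    using uv by (auto simp: jointly_strongly_epic_def)
  obtain p q where pb: "is_pullback C p q f m"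
    using pullback_exists[of f m] f ma by (auto simp: hom_iff)
  have pq: "p \<in> hom C (Dom C p) (Cod C u)" "q \<in> hom C (Dom C p) (Dom C m)" "f \<cdot> p = m \<cdot> q"
    using pb f by (auto simp: is_pullback_def hom_iff)
  have uvf: "u \<in> hom C (Dom C u) (Dom C f)" "v \<in> hom C (Dom C v) (Dom C f)"
    using f uva by (auto simp: hom_iff)
  have "\<exists>w\<in>hom C (Dom C u) (Dom C p). p \<cdot> w = u"
    by (rule pullback_factor[OF pb uvf(1) a]) blast
  moreover have "\<exists>w\<in>hom C (Dom C v) (Dom C p). p \<cdot> w = v"
    by (rule pullback_factor[OF pb uvf(2) b]) blast
  moreover have "is_subobject C (Cod C u) p"
    using pullback_mono[OF pb m] pq by (simp add: is_subobject_def hom_iff)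
  ultimately have "is_iso C p" using uv unfolding jointly_strongly_epic_def by blast
  then obtain i where i: "i \<in> hom C (Cod C u) (Dom C p)" "p \<cdot> i = Ident C (Cod C u)"
    using pq by (auto simp: is_iso_def hom_iff)
  have "m \<cdot> (q \<cdot> i) = f \<cdot> (p \<cdot> i)"
    using pq i f ma by - (rule comp_eq_extend; auto simp: hom_iff)
  also have "\<dots> = f" using i f by (simp add: hom_iff)
  finally have "m \<cdot> (q \<cdot> i) = f" .
  then show thesis using that[of "q \<cdot> i"] pq i by (simp add: hom_iff)
qed

end

section \<open>Joins as images\<close>

context category
begin

lemma regular_epi_cancel:
  assumes "is_regular_epi C e" "u \<in> hom C (Cod C e) T" "v \<in> hom C (Cod C e) T"
    "u \<cdot> e = v \<cdot> e"
  shows "u = v"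
proof -
  obtain f g where fg: "is_coequalizer C e f g" using assms(1) by (auto simp: is_regular_epi_def)
  then have ty: "e \<in> hom C (Cod C f) (Cod C e)" "f \<in> Arr C" "g \<in> hom C (Dom C f) (Cod C f)"
    "e \<cdot> f = e \<cdot> g"
    by (auto simp: is_coequalizer_def)
  have "(u \<cdot> e) \<cdot> f = (u \<cdot> e) \<cdot> g"
    using ty assms(2) by (simp add: hom_iff)
  moreover have "u \<cdot> e \<in> hom C (Cod C f) T" using ty assms(2) by (simp add: hom_iff)
  ultimately have "\<exists>!w. w \<in> hom C (Cod C e) T \<and> w \<cdot> e = u \<cdot> e"
    using fg unfolding is_coequalizer_def by blast
  then show ?thesis using assms by metis
qed

end

locale regular_category = finitely_complete_category +
  assumes regular: "regular C"
begin

text \<open>The usual factorization of a regular category, with \<open>e\<close> the coequalizer of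
  the kernel pair of \<open>f\<close>. The kernel pair is returned as well, since minimality of the
  image is later deduced from the universal property of \<open>e\<close>.\<close>

lemma image_factorization:
  assumes f: "f \<in> Arr C"
  obtains e m p q where "is_pullback C p q f f" "is_coequalizer C e p q" "is_mono C m"
    "m \<in> hom C (Cod C e) (Cod C f)" "m \<cdot> e = f"
proof -
  obtain p q where pb: "is_pullback C p q f f" using pullback_exists f by blast
  obtain e where co: "is_coequalizer C e p q" using regular pb unfolding regular_def by blast
  have pq: "p \<in> hom C (Dom C p) (Dom C f)" "q \<in> hom C (Dom C p) (Dom C f)" "f \<cdot> p = f \<cdot> q"
    using pb by (auto simp: is_pullback_def)
  have e: "e \<in> hom C (Dom C f) (Cod C e)" "e \<cdot> p = e \<cdot> q"
    using co pq by (auto simp: is_coequalizer_def hom_iff)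
  obtain m where m: "m \<in> hom C (Cod C e) (Cod C f)" "m \<cdot> e = f"
    using coequalizer_factor[OF co, of f "Cod C f"] pq f unfolding hom_iff by metis
  have re: "is_regular_epi C e" using co by (auto simp: is_regular_epi_def)
  have stable: "is_regular_epi C x" if "is_pullback C x y g e" for x y g
    using regular re that unfolding regular_def by blast
  have "is_mono C m"
    unfolding is_mono_def
  proof (intro conjI ballI impI; (elim conjE)?)
    show "m \<in> Arr C" using m by (simp add: hom_iff)
    fix u v
    assume "u \<in> Arr C" "v \<in> Arr C" "Dom C u = Dom C v" "Cod C u = Dom C m"
      "Cod C v = Dom C m" and muv: "m \<cdot> u = m \<cdot> v"
    then have uv: "u \<in> hom C (Dom C u) (Cod C e)" "v \<in> hom C (Dom C u) (Cod C e)"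
      using m by (auto simp: hom_iff)
    \<comment> \<open>Pulling back \<open>e\<close> covers the domain of \<open>u\<close> by a
      regular epi \<open>x\<close> after which \<open>u\<close> lifts through \<open>e\<close>. The
      arrow \<open>y\<close> below does the same for \<open>v \<cdot> x\<close>, so on the domain of
      \<open>y\<close> both lifts exist.\<close>
    obtain x a where xa: "is_pullback C x a u e"
      using pullback_exists[of u e] uv e by (auto simp: hom_iff)
    have x: "x \<in> hom C (Dom C x) (Dom C u)" "a \<in> hom C (Dom C x) (Dom C f)" "u \<cdot> x = e \<cdot> a"
      using xa uv e by (auto simp: is_pullback_def hom_iff)
    obtain y b where yb: "is_pullback C y b (v \<cdot> x) e"
      using pullback_exists[of "v \<cdot> x" e] uv e x by (auto simp: hom_iff)
    have y: "y \<in> hom C (Dom C y) (Dom C x)" "b \<in> hom C (Dom C y) (Dom C f)"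
      "v \<cdot> (x \<cdot> y) = e \<cdot> b"
      using yb uv e x by (auto simp: is_pullback_def hom_iff)
    have ux: "u \<cdot> (x \<cdot> y) = e \<cdot> (a \<cdot> y)"
      using x y uv e by - (rule comp_eq_extend; auto simp: hom_iff)
    have fc: "f \<cdot> z = m \<cdot> (e \<cdot> z)" if "z \<in> Arr C" "Cod C z = Dom C f" for z
    proof -
      have "(m \<cdot> e) \<cdot> z = m \<cdot> (e \<cdot> z)" using that m(1) e by (simp add: hom_iff)
      then show ?thesis unfolding m(2) .
    qed
    have "f \<cdot> (a \<cdot> y) = m \<cdot> (u \<cdot> (x \<cdot> y))"
      using fc ux x y by (simp add: hom_iff)
    also have "\<dots> = m \<cdot> (v \<cdot> (x \<cdot> y))"
      using muv m uv x y by - (rule comp_eq_extend; auto simp: hom_iff)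
    also have "\<dots> = f \<cdot> b" using fc y by (simp add: hom_iff)
    finally have fab: "f \<cdot> (a \<cdot> y) = f \<cdot> b" .
    have "a \<cdot> y \<in> hom C (Dom C y) (Dom C f)" using x y by (simp add: hom_iff)
    \<comment> \<open>The two lifts agree under \<open>f\<close>, so they factor jointly through its
      kernel pair, whose projections \<open>e\<close> identifies. Then \<open>y\<close> and
      \<open>x\<close> are cancelled in turn, being regular epis by stability.\<close>
    then obtain w where w: "w \<in> hom C (Dom C y) (Dom C p)" "p \<cdot> w = a \<cdot> y" "q \<cdot> w = b"
      using pullback_factor[OF pb] fab y(2) by blast
    have "e \<cdot> (p \<cdot> w) = e \<cdot> (q \<cdot> w)"
      using e pq w by - (rule comp_eq_extend; auto simp: hom_iff)
    then have uvxy: "u \<cdot> (x \<cdot> y) = v \<cdot> (x \<cdot> y)" using w ux y by simp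
    have uvx: "u \<cdot> x = v \<cdot> x"
      using uvxy uv x(1) y(1)
      by - (rule regular_epi_cancel[OF stable[OF yb], of _ "Cod C e"]; auto simp: hom_iff)
    then show "u = v"
      using uvx uv x(1)
      by - (rule regular_epi_cancel[OF stable[OF xa], of _ "Cod C e"]; auto simp: hom_iff)
  qed
  then show thesis using that pb co m by blast
qed

lemma join_exists:
  assumes cp: "has_binary_coproducts C" and h: "is_subobject C G h" and k: "is_subobject C G k"
  obtains j where "is_join C G h k j"
proof -
  have hk: "h \<in> hom C (Dom C h) G" "k \<in> hom C (Dom C k) G"
    using h k by (auto simp: is_subobject_def is_mono_def hom_iff)
  obtain i i' where ii: "is_coproduct C (Dom C h) (Dom C k) i i'"
    using cp hom_obj[OF hk(1)] hom_obj[OF hk(2)] unfolding has_binary_coproducts_def by blast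
  have i: "i \<in> hom C (Dom C h) (Cod C i)" "i' \<in> hom C (Dom C k) (Cod C i)"
    using ii by (auto simp: is_coproduct_def)
  obtain f where f: "f \<in> hom C (Cod C i) G" "f \<cdot> i = h" "f \<cdot> i' = k"
    by (rule coproduct_factor[OF ii hk])
  obtain e m p q where im: "is_pullback C p q f f" "is_coequalizer C e p q" "is_mono C m"
    "m \<in> hom C (Cod C e) (Cod C f)" "m \<cdot> e = f"
    by (rule image_factorization[of f]) (use f(1) in \<open>auto simp: hom_iff\<close>)
  have pq: "p \<in> hom C (Dom C p) (Cod C i)" "q \<in> hom C (Dom C p) (Cod C i)" "f \<cdot> p = f \<cdot> q"
    using im f by (auto simp: is_pullback_def hom_iff)
  have e: "e \<in> hom C (Cod C i) (Cod C e)"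
    using im pq by (auto simp: is_coequalizer_def hom_iff)
  have m: "m \<in> hom C (Cod C e) G" using im f by (simp add: hom_iff)
  have le: "sub_le C h m" "sub_le C k m"
  proof -
    have "(m \<cdot> e) \<cdot> i = m \<cdot> (e \<cdot> i)" "(m \<cdot> e) \<cdot> i' = m \<cdot> (e \<cdot> i')"
      using i e m by (simp_all add: hom_iff)
    then have "m \<cdot> (e \<cdot> i) = h" "m \<cdot> (e \<cdot> i') = k"
      unfolding im(5) f by simp_all
    moreover have "e \<cdot> i \<in> hom C (Dom C h) (Dom C m)" "e \<cdot> i' \<in> hom C (Dom C k) (Dom C m)"
      using i e m by (simp_all add: hom_iff)
    ultimately show "sub_le C h m" "sub_le C k m"
      unfolding sub_le_def by auto
  qed
  have "sub_le C m n"
    if n: "is_subobject C G n" and hn: "sub_le C h n" and kn: "sub_le C k n" for n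
  proof -
    have na: "n \<in> hom C (Dom C n) G" and nm: "is_mono C n"
      using n by (auto simp: is_subobject_def is_mono_def hom_iff)
    obtain u where u: "u \<in> hom C (Dom C h) (Dom C n)" "n \<cdot> u = h"
      using hn by (auto simp: sub_le_def)
    obtain v where v: "v \<in> hom C (Dom C k) (Dom C n)" "n \<cdot> v = k"
      using kn by (auto simp: sub_le_def)
    obtain x where x: "x \<in> hom C (Cod C i) (Dom C n)" "x \<cdot> i = u" "x \<cdot> i' = v"
      by (rule coproduct_factor[OF ii u(1) v(1)])
    have "(n \<cdot> x) \<cdot> i = n \<cdot> u" "(n \<cdot> x) \<cdot> i' = n \<cdot> v"
      using Comp_assoc[OF i(1) x(1) na] Comp_assoc[OF i(2) x(1) na] unfolding x by simp_all
    then have "n \<cdot> x = f"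
      unfolding u v f(2,3)[symmetric] by (rule coproduct_cancel[OF ii Comp_in[OF x(1) na] f(1)])
    have nx: "n \<cdot> (x \<cdot> z) = f \<cdot> z" if "z \<in> Arr C" "Cod C z = Cod C i" for z
      using Comp_assoc[OF _ x(1) na] that unfolding \<open>n \<cdot> x = f\<close> by (auto simp: hom_iff)
    \<comment> \<open>Since \<open>n \<cdot> x = f\<close> identifies the kernel pair of
      \<open>f\<close> and \<open>n\<close> is monic, \<open>x\<close> already identifies it, so
      \<open>x\<close> descends along \<open>e\<close> and places the image below
      \<open>n\<close>.\<close>
    have "x \<cdot> p = x \<cdot> q"
      using nx pq x by - (rule mono_cancel[OF nm, of _ _ "Dom C p"]; auto simp: hom_iff)
    then obtain w where w: "w \<in> hom C (Cod C e) (Dom C n)" "w \<cdot> e = x"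
      using coequalizer_factor[OF im(2), of x "Dom C n"] x(1) pq unfolding hom_iff by metis
    have "(n \<cdot> w) \<cdot> e = m \<cdot> e"
      using w im na e \<open>n \<cdot> x = f\<close> by (simp add: hom_iff)
    then have "n \<cdot> w = m"
      using im w na e m
      by - (rule regular_epi_cancel[of e _ G]; auto simp: is_regular_epi_def hom_iff)
    then show ?thesis using w m by (auto simp: sub_le_def hom_iff)
  qed
  then have "is_join C G h k m"
    unfolding is_join_def using le im m by (auto simp: is_subobject_def hom_iff)
  then show thesis by (rule that)
qed

end

section \<open>Restricting algebras of an adjunction monad\<close>

lemma functor_obj: "is_functor C D F \<Longrightarrow> A \<in> Obj C \<Longrightarrow> FO F A \<in> Obj D"
  by (simp add: is_functor_def)

lemma functor_hom: "is_functor C D F \<Longrightarrow> f \<in> hom C A B \<Longrightarrow> FA F f \<in> hom D (FO F A) (FO F B)"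
  by (auto simp: is_functor_def hom_iff)

lemma functor_comp:
  "is_functor C D F \<Longrightarrow> f \<in> hom C A B \<Longrightarrow> g \<in> hom C B E \<Longrightarrow>
    FA F (g \<cdot>\<^bsub>C\<^esub> f) = FA F g \<cdot>\<^bsub>D\<^esub> FA F f"
  by (auto simp: is_functor_def hom_iff)

text \<open>Only \<open>C\<close> is assumed finitely complete; \<open>D\<close>, later the category
  of points, is just a category. Unit, counit and triangle identities are chosen as data because
  \<open>adjunction_monad\<close> is built from them.\<close>

locale adjunction = C: finitely_complete_category C + D: category D
  for C :: "('o, 'a) cat" and D :: "('p, 'b) cat" +
  fixes F :: "('o, 'a, 'p, 'b) fctr" and U :: "('p, 'b, 'o, 'a) fctr"
    and \<eta> :: "'o \<Rightarrow> 'a" and \<epsilon> :: "'p \<Rightarrow> 'b"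
  assumes F: "is_functor C D F" and U: "is_functor D C U"
    and unit_in: "A \<in> Obj C \<Longrightarrow> \<eta> A \<in> hom C A (FO U (FO F A))"
    and counit_in: "X \<in> Obj D \<Longrightarrow> \<epsilon> X \<in> hom D (FO F (FO U X)) X"
    and unit_natural: "f \<in> hom C A B \<Longrightarrow> \<eta> B \<cdot>\<^bsub>C\<^esub> f = FA U (FA F f) \<cdot>\<^bsub>C\<^esub> \<eta> A"
    and counit_natural: "g \<in> hom D X Y \<Longrightarrow> \<epsilon> Y \<cdot>\<^bsub>D\<^esub> FA F (FA U g) = g \<cdot>\<^bsub>D\<^esub> \<epsilon> X"
    and triangle_left: "A \<in> Obj C \<Longrightarrow> \<epsilon> (FO F A) \<cdot>\<^bsub>D\<^esub> FA F (\<eta> A) = Ident D (FO F A)"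
    and triangle_right: "X \<in> Obj D \<Longrightarrow> FA U (\<epsilon> X) \<cdot>\<^bsub>C\<^esub> \<eta> (FO U X) = Ident C (FO U X)"
begin

lemmas F_hom = functor_hom[OF F] and U_hom = functor_hom[OF U]
lemmas F_comp = functor_comp[OF F] and U_comp = functor_comp[OF U]

text \<open>One half of the hom-set bijection, from naturality of the unit and a triangle identity.
  It makes transposition injective.\<close>

lemma transpose_transpose:
  assumes u: "u \<in> hom C T (FO U X)" and X: "X \<in> Obj D"
  shows "FA U (\<epsilon> X \<cdot>\<^bsub>D\<^esub> FA F u) \<cdot>\<^bsub>C\<^esub> \<eta> T = u"
proof -
  have T: "T \<in> Obj C" and UX: "FO U X \<in> Obj C" using C.hom_obj[OF u] by auto
  note ty = counit_in[OF X] F_hom[OF u] unit_in[OF T] unit_in[OF UX]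
    U_hom[OF counit_in[OF X]] U_hom[OF F_hom[OF u]]
  have "FA U (\<epsilon> X \<cdot>\<^bsub>D\<^esub> FA F u) \<cdot>\<^bsub>C\<^esub> \<eta> T = FA U (\<epsilon> X) \<cdot>\<^bsub>C\<^esub> (FA U (FA F u) \<cdot>\<^bsub>C\<^esub> \<eta> T)"
    using ty by (simp add: U_comp[OF ty(2,1)] C.Comp_assoc)
  also have "\<dots> = FA U (\<epsilon> X) \<cdot>\<^bsub>C\<^esub> (\<eta> (FO U X) \<cdot>\<^bsub>C\<^esub> u)" by (simp add: unit_natural[OF u])
  also have "\<dots> = Ident C (FO U X) \<cdot>\<^bsub>C\<^esub> u"
    by (simp only: C.Comp_assoc[OF u ty(4,5)] triangle_right[OF X])
  also have "\<dots> = u" using u by (rule C.Ident_left)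
  finally show ?thesis .
qed

lemma transpose_natural:
  assumes u: "u \<in> hom C T (FO U X)" and m: "m \<in> hom D X Y"
  shows "\<epsilon> Y \<cdot>\<^bsub>D\<^esub> FA F (FA U m \<cdot>\<^bsub>C\<^esub> u) = m \<cdot>\<^bsub>D\<^esub> (\<epsilon> X \<cdot>\<^bsub>D\<^esub> FA F u)"
proof -
  have X: "X \<in> Obj D" and Y: "Y \<in> Obj D" using D.hom_obj[OF m] by auto
  show ?thesis
    using D.Comp_assoc[OF F_hom[OF u] F_hom[OF U_hom[OF m]] counit_in[OF Y]]
      D.Comp_assoc[OF F_hom[OF u] counit_in[OF X] m]
    by (simp add: F_comp[OF u U_hom[OF m]] counit_natural[OF m])
qed

text \<open>Transposing turns an equation after \<open>U m\<close> into one after \<open>m\<close>;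
  there \<open>m\<close> cancels, and transposition is injective.\<close>

lemma right_adjoint_mono:
  assumes m: "is_mono D m"
  shows "is_mono C (FA U m)"
proof -
  have mh: "m \<in> hom D (Dom D m) (Cod D m)" using m by (simp add: is_mono_def hom_iff)
  have X: "Dom D m \<in> Obj D" using D.hom_obj[OF mh] by simp
  note Um = U_hom[OF mh]
  show ?thesis
    unfolding is_mono_def
  proof (intro conjI ballI impI; (elim conjE)?)
    show "FA U m \<in> Arr C" using Um by (simp add: hom_iff)
    fix u v
    assume "u \<in> Arr C" "v \<in> Arr C" "Dom C u = Dom C v" "Cod C u = Dom C (FA U m)"
      "Cod C v = Dom C (FA U m)" and eq: "FA U m \<cdot>\<^bsub>C\<^esub> u = FA U m \<cdot>\<^bsub>C\<^esub> v"
    then have uv: "u \<in> hom C (Dom C u) (FO U (Dom D m))" "v \<in> hom C (Dom C u) (FO U (Dom D m))"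
      using Um by (auto simp: hom_iff)
    have "\<epsilon> (Dom D m) \<cdot>\<^bsub>D\<^esub> FA F u = \<epsilon> (Dom D m) \<cdot>\<^bsub>D\<^esub> FA F v"
      using transpose_natural[OF uv(1) mh] transpose_natural[OF uv(2) mh] eq
        D.Comp_in[OF F_hom[OF uv(1)] counit_in[OF X]]
        D.Comp_in[OF F_hom[OF uv(2)] counit_in[OF X]]
      by - (rule D.mono_cancel[OF m]; simp)
    then show "u = v"
      using transpose_transpose[OF uv(1) X] transpose_transpose[OF uv(2) X] by metis
  qed
qed

lemma left_adjoint_jointly_strongly_epic:
  assumes uv: "jointly_strongly_epic C u v"
  shows "jointly_strongly_epic D (FA F u) (FA F v)"
proof -
  define J where "J = Cod C u"
  have u: "u \<in> hom C (Dom C u) J" and v: "v \<in> hom C (Dom C v) J"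
    using uv by (auto simp: jointly_strongly_epic_def hom_iff J_def)
  have J: "J \<in> Obj C" using C.hom_obj[OF u] by simp
  note Fu = F_hom[OF u] and Fv = F_hom[OF v]
  have "is_iso D m"
    if m: "is_subobject D (Cod D (FA F u)) m"
      and a: "a \<in> hom D (Dom D (FA F u)) (Dom D m)" "m \<cdot>\<^bsub>D\<^esub> a = FA F u"
      and b: "b \<in> hom D (Dom D (FA F v)) (Dom D m)" "m \<cdot>\<^bsub>D\<^esub> b = FA F v" for m a b
  proof -
    have mm: "is_mono D m" and mh: "m \<in> hom D (Dom D m) (FO F J)"
      using m Fu by (auto simp: is_subobject_def is_mono_def hom_iff)
    have X: "Dom D m \<in> Obj D" using D.hom_obj[OF mh] by simp
    note Um = U_hom[OF mh] and \<eta>J = unit_in[OF J]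
    \<comment> \<open>A factorization \<open>F w = m c\<close> in \<open>D\<close> becomes, by
      naturality of the unit, the factorization of \<open>\<eta> J\<close> after \<open>w\<close>
      through \<open>U m\<close> by \<open>U c\<close> after the unit.\<close>
    have factor: "\<exists>c\<in>hom C (Dom C w) (FO U (Dom D m)). \<eta> J \<cdot>\<^bsub>C\<^esub> w = FA U m \<cdot>\<^bsub>C\<^esub> c"
      if w: "w \<in> hom C (Dom C w) J" and c: "c \<in> hom D (FO F (Dom C w)) (Dom D m)"
        and mc: "m \<cdot>\<^bsub>D\<^esub> c = FA F w" for w c
    proof
      have W: "Dom C w \<in> Obj C" using C.hom_obj[OF w] by simp
      note Uc = U_hom[OF c] and \<eta>W = unit_in[OF W]
      have "\<eta> J \<cdot>\<^bsub>C\<^esub> w = FA U (m \<cdot>\<^bsub>D\<^esub> c) \<cdot>\<^bsub>C\<^esub> \<eta> (Dom C w)"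
        by (simp add: unit_natural[OF w] mc)
      then show "\<eta> J \<cdot>\<^bsub>C\<^esub> w = FA U m \<cdot>\<^bsub>C\<^esub> (FA U c \<cdot>\<^bsub>C\<^esub> \<eta> (Dom C w))"
        by (simp add: U_comp[OF c mh] C.Comp_assoc[OF \<eta>W Uc Um])
      show "FA U c \<cdot>\<^bsub>C\<^esub> \<eta> (Dom C w) \<in> hom C (Dom C w) (FO U (Dom D m))"
        by (rule C.Comp_in[OF \<eta>W Uc])
    qed
    obtain c where c: "c \<in> hom C (Dom C u) (FO U (Dom D m))" "\<eta> J \<cdot>\<^bsub>C\<^esub> u = FA U m \<cdot>\<^bsub>C\<^esub> c"
      using factor[OF u, of a] a Fu by (auto simp: hom_iff)
    obtain d where d: "d \<in> hom C (Dom C v) (FO U (Dom D m))" "\<eta> J \<cdot>\<^bsub>C\<^esub> v = FA U m \<cdot>\<^bsub>C\<^esub> d"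
      using factor[OF v, of b] b Fv by (auto simp: hom_iff)
    have Umd: "Dom C (FA U m) = FO U (Dom D m)" "Cod C (FA U m) = FO U (FO F J)"
      using Um by (auto simp: hom_iff)
    obtain r where r: "r \<in> hom C J (FO U (Dom D m))" "FA U m \<cdot>\<^bsub>C\<^esub> r = \<eta> J"
      by (rule C.jointly_strongly_epic_factor[OF uv right_adjoint_mono[OF mm], of "\<eta> J" c d])
        (use c d \<eta>J Umd in \<open>simp_all add: J_def\<close>)
    \<comment> \<open>The transpose of the lift \<open>r\<close>. By naturality \<open>m\<close>
      after \<open>?t\<close> is the transpose of \<open>U m\<close> after \<open>r\<close>, that is
      of \<open>\<eta> J\<close>, which is an identity.\<close>
    let ?t = "\<epsilon> (Dom D m) \<cdot>\<^bsub>D\<^esub> FA F r"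
    have t: "?t \<in> hom D (FO F J) (Dom D m)"
      by (rule D.Comp_in[OF F_hom[OF r(1)] counit_in[OF X]])
    have "m \<cdot>\<^bsub>D\<^esub> ?t = \<epsilon> (FO F J) \<cdot>\<^bsub>D\<^esub> FA F (\<eta> J)"
      using transpose_natural[OF r(1) mh] r(2) by simp
    then show ?thesis
      using D.mono_split_iso[OF mm, of ?t] t mh triangle_left[OF J] by (simp add: hom_iff)
  qed
  then show ?thesis
    unfolding jointly_strongly_epic_def using Fu Fv by (auto simp: hom_iff)
qed

section \<open>The induced monad and its subalgebras\<close>

abbreviation T where "T \<equiv> adjunction_monad F U \<eta> \<epsilon>"

lemma monad_simps:
  "FO (Endo T) A = FO U (FO F A)" "FA (Endo T) f = FA U (FA F f)"
  "Unit T = \<eta>" "Mult T A = FA U (\<epsilon> (FO F A))"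
  by (simp_all add: adjunction_monad_def)

lemma T_hom: "f \<in> hom C A B \<Longrightarrow> FA (Endo T) f \<in> hom C (FO (Endo T) A) (FO (Endo T) B)"
  unfolding monad_simps by (intro U_hom F_hom)

lemma T_comp:
  "f \<in> hom C A B \<Longrightarrow> g \<in> hom C B E \<Longrightarrow>
    FA (Endo T) (g \<cdot>\<^bsub>C\<^esub> f) = FA (Endo T) g \<cdot>\<^bsub>C\<^esub> FA (Endo T) f"
  unfolding monad_simps by (simp add: F_comp U_comp[OF F_hom F_hom])

lemma Unit_in: "A \<in> Obj C \<Longrightarrow> Unit T A \<in> hom C A (FO (Endo T) A)"
  unfolding monad_simps by (rule unit_in)

lemma Unit_natural: "f \<in> hom C A B \<Longrightarrow> Unit T B \<cdot>\<^bsub>C\<^esub> f = FA (Endo T) f \<cdot>\<^bsub>C\<^esub> Unit T A"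
  unfolding monad_simps by (rule unit_natural)

lemma Mult_in: "A \<in> Obj C \<Longrightarrow> Mult T A \<in> hom C (FO (Endo T) (FO (Endo T) A)) (FO (Endo T) A)"
  unfolding monad_simps by (intro U_hom counit_in functor_obj[OF F])

text \<open>This is naturality of the counit at \<open>F f\<close>, carried to \<open>C\<close> by
  \<open>U\<close>.\<close>

lemma Mult_natural:
  assumes f: "f \<in> hom C A B"
  shows "FA (Endo T) f \<cdot>\<^bsub>C\<^esub> Mult T A = Mult T B \<cdot>\<^bsub>C\<^esub> FA (Endo T) (FA (Endo T) f)"
proof -
  have AB: "FO F A \<in> Obj D" "FO F B \<in> Obj D" using D.hom_obj[OF F_hom[OF f]] by auto
  show ?thesis
    unfolding monad_simps
    by (simp add: counit_natural[OF F_hom[OF f]]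
        flip: U_comp[OF counit_in[OF AB(1)] F_hom[OF f]]
          U_comp[OF F_hom[OF U_hom[OF F_hom[OF f]]] counit_in[OF AB(2)]])
qed

text \<open>After composition with \<open>j\<close>, each law for \<open>b\<close> becomes the law
  for \<open>\<xi>\<close> precomposed with \<open>j\<close> or with \<open>T (T j)\<close>, by
  naturality of unit and multiplication.\<close>

lemma subalgebra:
  assumes \<xi>: "is_algebra C T G \<xi>" and j: "is_mono C j" "j \<in> hom C J G"
    and b: "b \<in> hom C (FO (Endo T) J) J" and jb: "j \<cdot>\<^bsub>C\<^esub> b = \<xi> \<cdot>\<^bsub>C\<^esub> FA (Endo T) j"
  shows "is_algebra C T J b"
proof -
  have G: "G \<in> Obj C" and J: "J \<in> Obj C" using C.hom_obj[OF j(2)] by auto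
  have \<xi>h: "\<xi> \<in> hom C (FO (Endo T) G) G" and \<xi>u: "\<xi> \<cdot>\<^bsub>C\<^esub> Unit T G = Ident C G"
    and \<xi>m: "\<xi> \<cdot>\<^bsub>C\<^esub> Mult T G = \<xi> \<cdot>\<^bsub>C\<^esub> FA (Endo T) \<xi>"
    using \<xi> by (auto simp: is_algebra_def)
  note Tj = T_hom[OF j(2)] and Tb = T_hom[OF b] and T\<xi> = T_hom[OF \<xi>h]
  note TTj = T_hom[OF Tj]
  have Dj: "Dom C j = J" using j(2) by (simp add: hom_iff)
  have "j \<cdot>\<^bsub>C\<^esub> (b \<cdot>\<^bsub>C\<^esub> Unit T J) = \<xi> \<cdot>\<^bsub>C\<^esub> (FA (Endo T) j \<cdot>\<^bsub>C\<^esub> Unit T J)"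
    by (simp only: C.Comp_assoc[OF Unit_in[OF J] b j(2)] jb C.Comp_assoc[OF Unit_in[OF J] Tj \<xi>h])
  also have "\<dots> = (\<xi> \<cdot>\<^bsub>C\<^esub> Unit T G) \<cdot>\<^bsub>C\<^esub> j"
    by (simp only: Unit_natural[OF j(2), symmetric] C.Comp_assoc[OF j(2) Unit_in[OF G] \<xi>h])
  also have "\<dots> = j \<cdot>\<^bsub>C\<^esub> Ident C J"
    by (simp only: \<xi>u C.Ident_left[OF j(2)] C.Ident_right[OF j(2)])
  finally have unit: "b \<cdot>\<^bsub>C\<^esub> Unit T J = Ident C J"
    by (rule C.mono_cancel[OF j(1), of _ _ J])
       (simp_all only: Dj C.Ident_in[OF J] C.Comp_in[OF Unit_in[OF J] b])
  have "j \<cdot>\<^bsub>C\<^esub> (b \<cdot>\<^bsub>C\<^esub> Mult T J) = \<xi> \<cdot>\<^bsub>C\<^esub> (FA (Endo T) j \<cdot>\<^bsub>C\<^esub> Mult T J)"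
    by (simp only: C.Comp_assoc[OF Mult_in[OF J] b j(2)] jb C.Comp_assoc[OF Mult_in[OF J] Tj \<xi>h])
  also have "\<dots> = (\<xi> \<cdot>\<^bsub>C\<^esub> Mult T G) \<cdot>\<^bsub>C\<^esub> FA (Endo T) (FA (Endo T) j)"
    by (simp only: Mult_natural[OF j(2)] C.Comp_assoc[OF TTj Mult_in[OF G] \<xi>h])
  also have "\<dots> = \<xi> \<cdot>\<^bsub>C\<^esub> FA (Endo T) (\<xi> \<cdot>\<^bsub>C\<^esub> FA (Endo T) j)"
    by (simp only: \<xi>m C.Comp_assoc[OF TTj T\<xi> \<xi>h] T_comp[OF Tj \<xi>h])
  also have "\<dots> = (\<xi> \<cdot>\<^bsub>C\<^esub> FA (Endo T) j) \<cdot>\<^bsub>C\<^esub> FA (Endo T) b"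
    by (simp only: jb[symmetric] T_comp[OF b j(2)] C.Comp_assoc[OF Tb Tj \<xi>h])
  also have "\<dots> = j \<cdot>\<^bsub>C\<^esub> (b \<cdot>\<^bsub>C\<^esub> FA (Endo T) b)"
    by (simp only: jb[symmetric] C.Comp_assoc[OF Tb b j(2)])
  finally have "b \<cdot>\<^bsub>C\<^esub> Mult T J = b \<cdot>\<^bsub>C\<^esub> FA (Endo T) b"
    by (rule C.mono_cancel[OF j(1), of _ _ "FO (Endo T) (FO (Endo T) J)"])
       (simp_all only: Dj C.Comp_in[OF Mult_in[OF J] b] C.Comp_in[OF Tb b])
  with unit show ?thesis using J b by (simp add: is_algebra_def)
qed

theorem join_subalgebra:
  assumes pres: "preserves_jointly_strongly_epic D C U"
    and \<xi>: "is_algebra C T G \<xi>" and join: "is_join C G h k j"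
    and hk: "h \<in> Arr C" "k \<in> Arr C"
    and a: "a \<in> hom C (FO (Endo T) (Dom C h)) (Dom C h)" "h \<cdot>\<^bsub>C\<^esub> a = \<xi> \<cdot>\<^bsub>C\<^esub> FA (Endo T) h"
    and b: "b \<in> hom C (FO (Endo T) (Dom C k)) (Dom C k)" "k \<cdot>\<^bsub>C\<^esub> b = \<xi> \<cdot>\<^bsub>C\<^esub> FA (Endo T) k"
  shows "\<exists>!c. is_algebra C T (Dom C j) c \<and> j \<cdot>\<^bsub>C\<^esub> c = \<xi> \<cdot>\<^bsub>C\<^esub> FA (Endo T) j"
proof -
  have jm: "is_mono C j" and j: "j \<in> hom C (Dom C j) G"
    using join by (auto simp: is_join_def is_subobject_def is_mono_def hom_iff)
  have \<xi>h: "\<xi> \<in> hom C (FO (Endo T) G) G" using \<xi> by (simp add: is_algebra_def)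
  obtain u where u: "u \<in> hom C (Dom C h) (Dom C j)" "j \<cdot>\<^bsub>C\<^esub> u = h"
    using join by (auto simp: is_join_def sub_le_def)
  obtain v where v: "v \<in> hom C (Dom C k) (Dom C j)" "j \<cdot>\<^bsub>C\<^esub> v = k"
    using join by (auto simp: is_join_def sub_le_def)
  note Tj = T_hom[OF j] and Tu = T_hom[OF u(1)] and Tv = T_hom[OF v(1)]
  \<comment> \<open>The pair passes through \<open>F\<close> by adjointness and through
    \<open>U\<close> by \<open>pres\<close>.\<close>
  have Te: "jointly_strongly_epic C (FA (Endo T) u) (FA (Endo T) v)"
    using pres left_adjoint_jointly_strongly_epic[OF C.join_jointly_strongly_epic[OF join u v]]
    by (simp add: preserves_jointly_strongly_epic_def monad_simps)
  let ?f = "\<xi> \<cdot>\<^bsub>C\<^esub> FA (Endo T) j"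
  \<comment> \<open>For both inclusions \<open>w\<close> of \<open>n\<close> into \<open>j\<close>:
    restricting along \<open>T w\<close> gives \<open>\<xi>\<close> after \<open>T n\<close>, which
    is \<open>n\<close> after \<open>c\<close>, and \<open>n\<close> factors through
    \<open>j\<close>.\<close>
  have factor: "?f \<cdot>\<^bsub>C\<^esub> FA (Endo T) w = j \<cdot>\<^bsub>C\<^esub> (w \<cdot>\<^bsub>C\<^esub> c)"
    if w: "w \<in> hom C (Dom C n) (Dom C j)" "j \<cdot>\<^bsub>C\<^esub> w = n"
      and c: "c \<in> hom C (FO (Endo T) (Dom C n)) (Dom C n)"
        "n \<cdot>\<^bsub>C\<^esub> c = \<xi> \<cdot>\<^bsub>C\<^esub> FA (Endo T) n" for n w c
  proof -
    have "?f \<cdot>\<^bsub>C\<^esub> FA (Endo T) w = \<xi> \<cdot>\<^bsub>C\<^esub> FA (Endo T) (j \<cdot>\<^bsub>C\<^esub> w)"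
      by (simp only: T_comp[OF w(1) j] C.Comp_assoc[OF T_hom[OF w(1)] Tj \<xi>h])
    also have "\<dots> = (j \<cdot>\<^bsub>C\<^esub> w) \<cdot>\<^bsub>C\<^esub> c" by (simp only: w c)
    also have "\<dots> = j \<cdot>\<^bsub>C\<^esub> (w \<cdot>\<^bsub>C\<^esub> c)" by (simp only: C.Comp_assoc[OF c(1) w(1) j])
    finally show ?thesis .
  qed
  have dom: "Dom C (FA (Endo T) u) = FO (Endo T) (Dom C h)"
    "Dom C (FA (Endo T) v) = FO (Endo T) (Dom C k)"
    "Cod C (FA (Endo T) u) = FO (Endo T) (Dom C j)" "Cod C j = G"
    using Tu Tv j by (auto simp: hom_iff)
  obtain c where c: "c \<in> hom C (FO (Endo T) (Dom C j)) (Dom C j)" "j \<cdot>\<^bsub>C\<^esub> c = ?f"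
    by (rule C.jointly_strongly_epic_factor[OF Te jm, of ?f "u \<cdot>\<^bsub>C\<^esub> a" "v \<cdot>\<^bsub>C\<^esub> b"])
      (simp_all only: dom factor[OF u a] factor[OF v b] C.Comp_in[OF Tj \<xi>h]
        C.Comp_in[OF a(1) u(1)] C.Comp_in[OF b(1) v(1)])
  show ?thesis
  proof (rule ex1I)
    show "is_algebra C T (Dom C j) c \<and> j \<cdot>\<^bsub>C\<^esub> c = ?f"
      using subalgebra[OF \<xi> jm j c] c by simp
    fix c' assume "is_algebra C T (Dom C j) c' \<and> j \<cdot>\<^bsub>C\<^esub> c' = ?f"
    then show "c' = c"
      using c by - (rule C.mono_cancel[OF jm]; auto simp: is_algebra_def)
  qed
qed

end

section \<open>The adjunction between coproduct and kernel\<close>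

context category
begin

lemma ex1_hom_zero:
  assumes "is_zero C Z" "A \<in> Obj C"
  shows "\<exists>!f. f \<in> hom C A Z" "\<exists>!f. f \<in> hom C Z A"
  using assms by (simp_all add: is_zero_def)

text \<open>Independence of the zero object: the arrow \<open>t\<close> between two zero objects
  satisfies \<open>t u = u'\<close> and \<open>v' t = v\<close> by uniqueness, so
  \<open>v' u' = v' t u = v u\<close>.\<close>

lemma zero_arr_eq:
  assumes Z: "is_zero C Z" and u: "u \<in> hom C A Z" and v: "v \<in> hom C Z B"
  shows "zero_arr C A B = v \<cdot> u"
  unfolding zero_arr_def
proof (rule the_equality)
  show "\<exists>Z u' v'. is_zero C Z \<and> u' \<in> hom C A Z \<and> v' \<in> hom C Z B \<and> v \<cdot> u = v' \<cdot> u'"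
    using assms by blast
  fix f assume "\<exists>Z u v. is_zero C Z \<and> u \<in> hom C A Z \<and> v \<in> hom C Z B \<and> f = v \<cdot> u"
  then obtain Z' u' v' where Z': "is_zero C Z'" and u': "u' \<in> hom C A Z'"
    and v': "v' \<in> hom C Z' B" and f: "f = v' \<cdot> u'"
    by blast
  obtain t where t: "t \<in> hom C Z Z'" using ex1_hom_zero(2)[OF Z hom_obj(2)[OF u']] by blast
  have "t \<cdot> u = u'" using ex1_hom_zero(1)[OF Z' hom_obj(1)[OF u]] Comp_in[OF u t] u' by blast
  moreover have "v' \<cdot> t = v"
    using ex1_hom_zero(2)[OF Z hom_obj(2)[OF v]] Comp_in[OF t v'] v by blast
  ultimately show "f = v \<cdot> u" using Comp_assoc[OF u t v'] f by simp
qed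

section \<open>The category of points over a fixed object\<close>

lemma point_hom_iff:
  "\<phi> \<in> hom (Pt C B) (A, p, s) (A', p', s') \<longleftrightarrow>
    (\<exists>f. \<phi> = ((A, p, s), f, (A', p', s')) \<and> (A, p, s) \<in> points C B \<and> (A', p', s') \<in> points C B \<and>
      f \<in> hom C A A' \<and> p' \<cdot> f = p \<and> f \<cdot> s = s')"
  by (auto simp: Pt_def hom_iff)

lemma Pt_simps:
  "Obj (Pt C B) = points C B" "Dom (Pt C B) (X, f, Y) = X" "Cod (Pt C B) (X, f, Y) = Y"
  "Ident (Pt C B) X = (X, Ident C (fst X), X)"
  "(Y, g, Z) \<cdot>\<^bsub>Pt C B\<^esub> (X, f, Y') = (X, g \<cdot> f, Z)"
  by (simp_all add: Pt_def)

lemma point_homE: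
  assumes "\<phi> \<in> hom (Pt C B) X Y"
  obtains f where "\<phi> = (X, f, Y)" "X \<in> points C B" "Y \<in> points C B"
    "f \<in> hom C (fst X) (fst Y)" "fst (snd Y) \<cdot> f = fst (snd X)" "f \<cdot> snd (snd X) = snd (snd Y)"
  using assms by (cases X, cases Y) (auto simp: point_hom_iff)

lemma category_Pt: "category (Pt C B)"
proof
  fix \<phi> assume "\<phi> \<in> Arr (Pt C B)"
  then show "Dom (Pt C B) \<phi> \<in> Obj (Pt C B)" "Cod (Pt C B) \<phi> \<in> Obj (Pt C B)"
    by (auto simp: Pt_def)
next
  fix X assume "X \<in> Obj (Pt C B)"
  then obtain A p s where X: "X = (A, p, s)" "(A, p, s) \<in> points C B"
    by (cases X) (auto simp: Pt_simps)
  then have ps: "p \<in> hom C A B" "s \<in> hom C B A" by (auto simp: points_def)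
  then have "A \<in> Obj C" using hom_obj by blast
  then show "Ident (Pt C B) X \<in> hom (Pt C B) X X"
    using X ps by (simp add: point_hom_iff Pt_simps Ident_in Ident_left[OF ps(2)] Ident_right[OF ps(1)])
next
  fix \<phi> \<psi> X Y Z assume \<phi>: "\<phi> \<in> hom (Pt C B) X Y" and \<psi>: "\<psi> \<in> hom (Pt C B) Y Z"
  obtain A p s A' p' s' A'' p'' s'' where
    XYZ: "X = (A, p, s)" "Y = (A', p', s')" "Z = (A'', p'', s'')"
    by (cases X, cases Y, cases Z)
  obtain f where f: "\<phi> = (X, f, Y)" "X \<in> points C B" "f \<in> hom C A A'" "p' \<cdot> f = p" "f \<cdot> s = s'"
    by (rule point_homE[OF \<phi>]) (simp add: XYZ)
  obtain g where g: "\<psi> = (Y, g, Z)" "Z \<in> points C B" "g \<in> hom C A' A''" "p'' \<cdot> g = p'"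
    "g \<cdot> s' = s''"
    by (rule point_homE[OF \<psi>]) (simp add: XYZ)
  have s: "s \<in> hom C B A" and p: "p'' \<in> hom C A'' B" using f g by (auto simp: points_def XYZ)
  have "p'' \<cdot> (g \<cdot> f) = p" by (simp only: Comp_assoc[OF f(3) g(3) p] g f)
  moreover have "(g \<cdot> f) \<cdot> s = s''" by (simp only: Comp_assoc[OF s f(3) g(3), symmetric] g f)
  ultimately show "\<psi> \<cdot>\<^bsub>Pt C B\<^esub> \<phi> \<in> hom (Pt C B) X Z"
    using f g Comp_in[OF f(3) g(3)] by (simp add: point_hom_iff Pt_simps XYZ)
next
  fix \<phi> X Y assume \<phi>: "\<phi> \<in> hom (Pt C B) X Y"
  obtain f where "\<phi> = (X, f, Y)" "f \<in> hom C (fst X) (fst Y)"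
    by (rule point_homE[OF \<phi>])
  then show "Ident (Pt C B) Y \<cdot>\<^bsub>Pt C B\<^esub> \<phi> = \<phi>" "\<phi> \<cdot>\<^bsub>Pt C B\<^esub> Ident (Pt C B) X = \<phi>"
    by (auto simp: Pt_simps Ident_left Ident_right)
next
  fix \<phi> \<psi> \<chi> X Y Z W
  assume \<phi>: "\<phi> \<in> hom (Pt C B) X Y" and \<psi>: "\<psi> \<in> hom (Pt C B) Y Z"
    and \<chi>: "\<chi> \<in> hom (Pt C B) Z W"
  obtain f where f: "\<phi> = (X, f, Y)" "f \<in> hom C (fst X) (fst Y)" by (rule point_homE[OF \<phi>])
  obtain g where g: "\<psi> = (Y, g, Z)" "g \<in> hom C (fst Y) (fst Z)" by (rule point_homE[OF \<psi>])
  obtain e where e: "\<chi> = (Z, e, W)" "e \<in> hom C (fst Z) (fst W)" by (rule point_homE[OF \<chi>])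
  show "\<chi> \<cdot>\<^bsub>Pt C B\<^esub> (\<psi> \<cdot>\<^bsub>Pt C B\<^esub> \<phi>) = (\<chi> \<cdot>\<^bsub>Pt C B\<^esub> \<psi>) \<cdot>\<^bsub>Pt C B\<^esub> \<phi>"
    unfolding f(1) g(1) e(1) Pt_simps Comp_assoc[OF f(2) g(2) e(2)] ..
qed

end

section \<open>Universal properties of the chosen zero arrows, kernels and coproducts; the kernel
  functor\<close>

locale pointed_category_with_coproducts = finitely_complete_category +
  assumes pointed: "pointed C" and coproducts: "has_binary_coproducts C"
begin

lemma zero_arr_factor:
  assumes "A \<in> Obj C" "B \<in> Obj C"
  obtains Z u v where "is_zero C Z" "u \<in> hom C A Z" "v \<in> hom C Z B" "zero_arr C A B = v \<cdot> u"
proof -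
  obtain Z where Z: "is_zero C Z" using pointed by (auto simp: pointed_def)
  obtain u where u: "u \<in> hom C A Z" using ex1_hom_zero(1)[OF Z assms(1)] by blast
  obtain v where v: "v \<in> hom C Z B" using ex1_hom_zero(2)[OF Z assms(2)] by blast
  show thesis by (rule that[OF Z u v zero_arr_eq[OF Z u v]])
qed

lemma zero_arr_in:
  assumes "A \<in> Obj C" "B \<in> Obj C"
  shows "zero_arr C A B \<in> hom C A B"
proof -
  obtain Z u v where "is_zero C Z" "u \<in> hom C A Z" "v \<in> hom C Z B" "zero_arr C A B = v \<cdot> u"
    by (rule zero_arr_factor[OF assms])
  then show ?thesis using Comp_in[of u A Z v B] by simp
qed

lemma zero_arr_comp:
  assumes "D \<in> Obj C" "f \<in> hom C A B"
  shows "zero_arr C B D \<cdot> f = zero_arr C A D"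
proof -
  obtain Z u v where Z: "is_zero C Z" "u \<in> hom C B Z" "v \<in> hom C Z D" "zero_arr C B D = v \<cdot> u"
    by (rule zero_arr_factor[OF hom_obj(2)[OF assms(2)] assms(1)])
  show ?thesis
    using zero_arr_eq[OF Z(1) Comp_in[OF assms(2) Z(2)] Z(3)] Comp_assoc[OF assms(2) Z(2,3)] Z(4)
    by simp
qed

text \<open>A kernel is the pullback of the arrow \<open>z\<close> from a zero object. Arrows into a
  zero object are unique, so \<open>z\<close> is monic, hence so is its pullback, which gives
  uniqueness of factorizations.\<close>

lemma kernel_exists:
  assumes f: "f \<in> hom C A B"
  shows "\<exists>k. is_kernel C k f"
proof -
  have B: "B \<in> Obj C" using hom_obj[OF f] by simp
  obtain Z where Z: "is_zero C Z" using pointed by (auto simp: pointed_def)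
  obtain z where z: "z \<in> hom C Z B" using ex1_hom_zero(2)[OF Z B] by blast
  have fz: "Dom C f = A" "Cod C f = B" "Dom C z = Z" "Cod C z = B" "f \<in> Arr C" "z \<in> Arr C"
    using f z by (auto simp: hom_iff)
  obtain p q where pb: "is_pullback C p q f z" using pullback_exists[of f z] fz by metis
  have pq: "p \<in> hom C (Dom C p) A" "q \<in> hom C (Dom C p) Z" "f \<cdot> p = z \<cdot> q"
    using pb fz unfolding is_pullback_def by auto
  have pm: "is_mono C p"
  proof (rule pullback_mono[OF pb])
    show "is_mono C z"
      unfolding is_mono_def
    proof (intro conjI ballI impI; (elim conjE)?)
      fix u v assume uv: "u \<in> Arr C" "v \<in> Arr C" "Dom C u = Dom C v" "Cod C u = Dom C z"
        "Cod C v = Dom C z"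
      then have "u \<in> hom C (Dom C u) Z" "v \<in> hom C (Dom C u) Z" using fz by (auto simp: hom_iff)
      moreover have "\<exists>!x. x \<in> hom C (Dom C u) Z" using ex1_hom_zero(1)[OF Z] uv(1) by simp
      ultimately show "u = v" by blast
    qed (fact fz)
  qed
  have "\<exists>!w. w \<in> hom C T (Dom C p) \<and> p \<cdot> w = u"
    if u: "u \<in> hom C T A" and fu: "f \<cdot> u = zero_arr C T B" for T u
  proof -
    have "T \<in> Obj C" using hom_obj[OF u] by simp
    then obtain v where v: "v \<in> hom C T Z" using ex1_hom_zero(1)[OF Z] by blast
    have "f \<cdot> u = z \<cdot> v" using fu zero_arr_eq[OF Z v z] by simp
    then obtain w where w: "w \<in> hom C T (Dom C p)" "p \<cdot> w = u"
      using pullback_factor[OF pb, of u T v] u v fz by metis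
    have "x = w" if "x \<in> hom C T (Dom C p)" "p \<cdot> x = u" for x
      using mono_cancel[OF pm _ that(1) w(1)] that(2) w(2) by simp
    with w show ?thesis by blast
  qed
  then have "is_kernel C p f"
    unfolding is_kernel_def using pq fz zero_arr_eq[OF Z pq(2) z] by simp
  then show ?thesis by blast
qed

lemma is_kernel_ker: "f \<in> hom C A B \<Longrightarrow> is_kernel C (ker C f) f"
  unfolding ker_def by (rule someI_ex[OF kernel_exists])

lemma ker_in: "f \<in> hom C A B \<Longrightarrow> ker C f \<in> hom C (ker_obj C f) A"
  using is_kernel_ker by (force simp: is_kernel_def ker_obj_def hom_iff)

lemma comp_ker: "f \<in> hom C A B \<Longrightarrow> f \<cdot> ker C f = zero_arr C (ker_obj C f) B"
  using is_kernel_ker by (force simp: is_kernel_def ker_obj_def hom_iff)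

lemma ker_factor:
  assumes f: "f \<in> hom C A B" and u: "u \<in> hom C T A" and fu: "f \<cdot> u = zero_arr C T B"
  shows "\<exists>!w. w \<in> hom C T (ker_obj C f) \<and> ker C f \<cdot> w = u"
proof -
  have "Dom C f = A" "Cod C f = B" using f by (auto simp: hom_iff)
  then show ?thesis
    using is_kernel_ker[OF f] u fu unfolding is_kernel_def ker_obj_def by simp
qed

lemma ker_cancel:
  assumes f: "f \<in> hom C A B" and w: "w \<in> hom C T (ker_obj C f)" "w' \<in> hom C T (ker_obj C f)"
    and eq: "ker C f \<cdot> w = ker C f \<cdot> w'"
  shows "w = w'"
proof -
  have T: "T \<in> Obj C" using hom_obj[OF w(1)] by simp
  have "f \<cdot> (ker C f \<cdot> w) = zero_arr C T B"
    using Comp_assoc[OF w(1) ker_in[OF f] f] zero_arr_comp[OF hom_obj(2)[OF f] w(1)]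
    by (simp add: comp_ker[OF f])
  from ker_factor[OF f Comp_in[OF w(1) ker_in[OF f]] this] w eq show ?thesis by metis
qed

lemma is_coproduct_inl_inr:
  assumes "A \<in> Obj C" "B \<in> Obj C"
  shows "is_coproduct C A B (inl C A B) (inr C A B)"
proof -
  have "\<exists>x. case x of (i, j) \<Rightarrow> is_coproduct C A B i j"
    using coproducts assms unfolding has_binary_coproducts_def by fastforce
  from someI_ex[OF this] show ?thesis
    by (simp add: inl_def inr_def coprod_def case_prod_unfold)
qed

lemma inl_in: "A \<in> Obj C \<Longrightarrow> B \<in> Obj C \<Longrightarrow> inl C A B \<in> hom C A (coprod_obj C A B)"
  and inr_in: "A \<in> Obj C \<Longrightarrow> B \<in> Obj C \<Longrightarrow> inr C A B \<in> hom C B (coprod_obj C A B)"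
  using is_coproduct_inl_inr by (auto simp: is_coproduct_def coprod_obj_def)

lemma copair:
  assumes f: "f \<in> hom C A T" and g: "g \<in> hom C B T"
  shows "copair C f g \<in> hom C (coprod_obj C A B) T"
    and "copair C f g \<cdot> inl C A B = f" and "copair C f g \<cdot> inr C A B = g"
proof -
  have fg: "Dom C f = A" "Dom C g = B" "Cod C f = T" using f g by (auto simp: hom_iff)
  have "\<exists>!w. w \<in> hom C (coprod_obj C A B) T \<and> w \<cdot> inl C A B = f \<and> w \<cdot> inr C A B = g"
    using is_coproduct_inl_inr[OF hom_obj(1)[OF f] hom_obj(1)[OF g]] f g
    unfolding is_coproduct_def coprod_obj_def by blast
  from theI'[OF this]
  show "copair C f g \<in> hom C (coprod_obj C A B) T"
    and "copair C f g \<cdot> inl C A B = f" and "copair C f g \<cdot> inr C A B = g"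
    unfolding copair_def fg by auto
qed

lemma coprod_cancel:
  assumes "A \<in> Obj C" "B \<in> Obj C"
    and "w \<in> hom C (coprod_obj C A B) T" "w' \<in> hom C (coprod_obj C A B) T"
    and "w \<cdot> inl C A B = w' \<cdot> inl C A B" "w \<cdot> inr C A B = w' \<cdot> inr C A B"
  shows "w = w'"
  using coproduct_cancel[OF is_coproduct_inl_inr[OF assms(1,2)]] assms(3-)
  by (simp add: coprod_obj_def)

text \<open>The description defining the arrow part denotes because
  \<open>p' f (ker p) = p (ker p) = 0\<close>, so \<open>f (ker p)\<close> factors uniquely through
  the kernel of \<open>p'\<close>.\<close>

lemma ker_functor_arr:
  assumes p: "p \<in> hom C A B" and p': "p' \<in> hom C A' B" and f: "f \<in> hom C A A'" and eq: "p' \<cdot> f = p"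
  shows "FA (ker_functor C B) ((A, p, s), f, (A', p', s')) \<in> hom C (ker_obj C p) (ker_obj C p')"
    and "ker C p' \<cdot> FA (ker_functor C B) ((A, p, s), f, (A', p', s')) = f \<cdot> ker C p"
proof -
  have "p' \<cdot> (f \<cdot> ker C p) = zero_arr C (ker_obj C p) B"
    using Comp_assoc[OF ker_in[OF p] f p'] by (simp add: eq comp_ker[OF p])
  from theI'[OF ker_factor[OF p' Comp_in[OF ker_in[OF p] f] this]]
  show "FA (ker_functor C B) ((A, p, s), f, (A', p', s')) \<in> hom C (ker_obj C p) (ker_obj C p')"
    and "ker C p' \<cdot> FA (ker_functor C B) ((A, p, s), f, (A', p', s')) = f \<cdot> ker C p"
    by (simp_all add: ker_functor_def)
qed

lemma is_functor_ker: "is_functor (Pt C B) C (ker_functor C B)"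
  unfolding is_functor_def
proof (intro conjI ballI impI)
  have FO: "FO (ker_functor C B) (A, p, s) = ker_obj C p" for A p s
    by (simp add: ker_functor_def)
  fix X assume "X \<in> Obj (Pt C B)"
  then obtain A p s where X: "X = (A, p, s)" and p: "p \<in> hom C A B"
    by (cases X) (auto simp: Pt_simps points_def)
  have A: "A \<in> Obj C" and K: "ker_obj C p \<in> Obj C"
    using hom_obj[OF p] hom_obj[OF ker_in[OF p]] by auto
  show "FO (ker_functor C B) X \<in> Obj C" using K by (simp add: X FO)
  show "FA (ker_functor C B) (Ident (Pt C B) X) = Ident C (FO (ker_functor C B) X)"
    unfolding X Pt_simps FO fst_conv
    using ker_functor_arr[OF p p Ident_in[OF A] Ident_right[OF p], of s s]
    by (intro ker_cancel[OF p _ Ident_in[OF K]])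
      (simp_all only: Ident_left[OF ker_in[OF p]] Ident_right[OF ker_in[OF p]])
next
  fix \<phi> assume "\<phi> \<in> Arr (Pt C B)"
  then obtain A p s f A' p' s' where "\<phi> = ((A, p, s), f, (A', p', s'))" "p \<in> hom C A B"
    "p' \<in> hom C A' B" "f \<in> hom C A A'" "p' \<cdot> f = p"
    by (auto simp: Pt_def points_def)
  then show "FA (ker_functor C B) \<phi> \<in>
      hom C (FO (ker_functor C B) (Dom (Pt C B) \<phi>)) (FO (ker_functor C B) (Cod (Pt C B) \<phi>))"
    using ker_functor_arr(1)[of p A B p' A' f s s'] by (simp add: Pt_simps ker_functor_def)
next
  fix \<phi> \<psi> assume arr: "\<phi> \<in> Arr (Pt C B)" "\<psi> \<in> Arr (Pt C B)" "Cod (Pt C B) \<phi> = Dom (Pt C B) \<psi>"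
  obtain A p s f A' p' s' where \<phi>: "\<phi> = ((A, p, s), f, (A', p', s'))" and p: "p \<in> hom C A B"
    and p': "p' \<in> hom C A' B" and f: "f \<in> hom C A A'" "p' \<cdot> f = p"
    using arr(1) by (auto simp: Pt_def points_def)
  obtain g A'' p'' s'' where \<psi>: "\<psi> = ((A', p', s'), g, (A'', p'', s''))"
    and p'': "p'' \<in> hom C A'' B" and g: "g \<in> hom C A' A''" "p'' \<cdot> g = p'"
    using arr(2,3) unfolding \<phi> by (auto simp: Pt_def points_def)
  have gf: "p'' \<cdot> (g \<cdot> f) = p" using Comp_assoc[OF f(1) g(1) p''] f g by simp
  let ?Kf = "FA (ker_functor C B) \<phi>" and ?Kg = "FA (ker_functor C B) \<psi>"
  note Kf = ker_functor_arr[OF p p' f, of s s', folded \<phi>]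
  note Kg = ker_functor_arr[OF p' p'' g, of s' s'', folded \<psi>]
  have "ker C p'' \<cdot> (?Kg \<cdot> ?Kf) = (g \<cdot> ker C p') \<cdot> ?Kf"
    by (simp only: Comp_assoc[OF Kf(1) Kg(1) ker_in[OF p'']] Kg(2))
  also have "\<dots> = (g \<cdot> f) \<cdot> ker C p"
    by (simp only: Comp_assoc[OF Kf(1) ker_in[OF p'] g(1), symmetric] Kf(2)
        Comp_assoc[OF ker_in[OF p] f(1) g(1)])
  finally show "FA (ker_functor C B) (\<psi> \<cdot>\<^bsub>Pt C B\<^esub> \<phi>) = ?Kg \<cdot> ?Kf"
    using ker_functor_arr[OF p p'' Comp_in[OF f(1) g(1)] gf, of s s''] Comp_in[OF Kf(1) Kg(1)]
    unfolding \<phi> \<psi> Pt_simps by - (rule ker_cancel[OF p'']; simp)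
qed

end

section \<open>Unit, counit and triangle identities for a fixed acting object\<close>

locale coproduct_kernel_adjunction = pointed_category_with_coproducts +
  fixes B
  assumes B: "B \<in> Obj C"
begin

text \<open>These are \<open>[1,0] : B + X -> B\<close> and \<open>1 + f\<close>, the arrows
  underlying \<open>plus_point\<close> and \<open>plus_functor\<close>.\<close>

abbreviation aug where "aug X \<equiv> copair C (Ident C B) (zero_arr C X B)"
abbreviation plus where "plus f \<equiv> copair C (inl C B (Cod C f)) (inr C B (Cod C f) \<cdot> f)"

lemmas inl_in_B = inl_in[OF B] and inr_in_B = inr_in[OF B]

lemma aug:
  assumes "X \<in> Obj C"
  shows "aug X \<in> hom C (coprod_obj C B X) B"
    "aug X \<cdot> inl C B X = Ident C B" "aug X \<cdot> inr C B X = zero_arr C X B"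
  using copair[OF Ident_in[OF B] zero_arr_in[OF assms B]] by auto

lemma plus:
  assumes f: "f \<in> hom C X Y"
  shows "plus f \<in> hom C (coprod_obj C B X) (coprod_obj C B Y)"
    "plus f \<cdot> inl C B X = inl C B Y" "plus f \<cdot> inr C B X = inr C B Y \<cdot> f"
proof -
  have Y: "Y \<in> Obj C" "Cod C f = Y" using f hom_obj[OF f] by (auto simp: hom_iff)
  show "plus f \<in> hom C (coprod_obj C B X) (coprod_obj C B Y)"
    "plus f \<cdot> inl C B X = inl C B Y" "plus f \<cdot> inr C B X = inr C B Y \<cdot> f"
    unfolding Y using copair[OF inl_in_B[OF Y(1)] Comp_in[OF f inr_in_B[OF Y(1)]]] by auto
qed

lemma plus_point_in: "X \<in> Obj C \<Longrightarrow> plus_point C B X \<in> points C B"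
  using aug inl_in_B by (simp add: plus_point_def points_def)

text \<open>Compatibility with \<open>[1,0]\<close> is tested on the injections: on \<open>B\<close>
  both sides are the identity, on \<open>X\<close> both are zero.\<close>

lemma plus_hom:
  assumes f: "f \<in> hom C X Y"
  shows "FA (plus_functor C B) f \<in> hom (Pt C B) (plus_point C B X) (plus_point C B Y)"
proof -
  have XY: "X \<in> Obj C" "Y \<in> Obj C" "Dom C f = X" "Cod C f = Y"
    using f hom_obj[OF f] by (auto simp: hom_iff)
  have "aug Y \<cdot> plus f = aug X"
  proof (rule coprod_cancel[OF B XY(1) Comp_in[OF plus(1)[OF f] aug(1)] aug(1)])
    show "(aug Y \<cdot> plus f) \<cdot> inl C B X = aug X \<cdot> inl C B X"
      by (simp only: Comp_assoc[OF inl_in_B[OF XY(1)] plus(1)[OF f] aug(1)[OF XY(2)], symmetric]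
          plus(2)[OF f] aug[OF XY(1)] aug[OF XY(2)])
    show "(aug Y \<cdot> plus f) \<cdot> inr C B X = aug X \<cdot> inr C B X"
      by (simp only: Comp_assoc[OF inr_in_B[OF XY(1)] plus(1)[OF f] aug(1)[OF XY(2)], symmetric]
          plus(3)[OF f] Comp_assoc[OF f inr_in_B[OF XY(2)] aug(1)[OF XY(2)]]
          aug[OF XY(1)] aug[OF XY(2)] zero_arr_comp[OF B f])
  qed (use XY in auto)
  then show ?thesis
    using plus[OF f] plus_point_in XY
    unfolding plus_point_def plus_functor_def by (auto simp: point_hom_iff)
qed

lemma is_functor_plus: "is_functor C (Pt C B) (plus_functor C B)"
  unfolding is_functor_def
proof (intro conjI ballI impI)
  fix X assume X: "X \<in> Obj C"
  then show "FO (plus_functor C B) X \<in> Obj (Pt C B)"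
    using plus_point_in by (simp add: plus_functor_def Pt_simps)
  note id = Ident_in[OF X]
  have "plus (Ident C X) = Ident C (coprod_obj C B X)"
    using hom_obj(2)[OF inl_in_B[OF X]]
    by (intro coprod_cancel[OF B X plus(1)[OF id] Ident_in])
      (simp_all only: plus[OF id] Ident_left[OF inl_in_B[OF X]] Ident_left[OF inr_in_B[OF X]]
        Ident_right[OF inr_in_B[OF X]])
  then show "FA (plus_functor C B) (Ident C X) = Ident (Pt C B) (FO (plus_functor C B) X)"
    using X by (simp add: plus_functor_def Pt_simps plus_point_def)
next
  fix f assume "f \<in> Arr C"
  then show "FA (plus_functor C B) f \<in> hom (Pt C B) (FO (plus_functor C B) (Dom C f))
      (FO (plus_functor C B) (Cod C f))"
    using plus_hom[of f "Dom C f" "Cod C f"] by (simp add: hom_iff plus_functor_def)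
next
  fix f g assume fg: "f \<in> Arr C" "g \<in> Arr C" "Cod C f = Dom C g"
  define X Y Z where "X = Dom C f" and "Y = Cod C f" and "Z = Cod C g"
  have f: "f \<in> hom C X Y" and g: "g \<in> hom C Y Z"
    using fg by (auto simp: hom_iff X_def Y_def Z_def)
  have X: "X \<in> Obj C" and Y: "Y \<in> Obj C" and Z: "Z \<in> Obj C"
    using hom_obj[OF f] hom_obj[OF g] by auto
  note gf = Comp_in[OF f g]
  have "plus (g \<cdot> f) = plus g \<cdot> plus f"
    by (rule coprod_cancel[OF B X plus(1)[OF gf] Comp_in[OF plus(1)[OF f] plus(1)[OF g]]])
      (simp_all only: plus[OF f] plus[OF g] plus[OF gf]
        Comp_assoc[OF inl_in_B[OF X] plus(1)[OF f] plus(1)[OF g], symmetric]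
        Comp_assoc[OF inr_in_B[OF X] plus(1)[OF f] plus(1)[OF g], symmetric]
        Comp_assoc[OF f inr_in_B[OF Y] plus(1)[OF g]]
        Comp_assoc[OF f g inr_in_B[OF Z]])
  then show "FA (plus_functor C B) (g \<cdot> f) = FA (plus_functor C B) g \<cdot>\<^bsub>Pt C B\<^esub> FA (plus_functor C B) f"
    using fg by (simp add: plus_functor_def Pt_simps)
qed

lemma ker_plus_obj: "FO (ker_functor C B) (FO (plus_functor C B) X) = ker_obj C (aug X)"
  by (simp add: ker_functor_def plus_functor_def plus_point_def)

lemma unit:
  assumes X: "X \<in> Obj C"
  shows "plus_ker_unit C B X \<in> hom C X (ker_obj C (aug X))"
    and "ker C (aug X) \<cdot> plus_ker_unit C B X = inr C B X"
  using theI'[OF ker_factor[OF aug(1)[OF X] inr_in_B[OF X] aug(3)[OF X]]]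
  by (auto simp: plus_ker_unit_def ker_obj_def Let_def)

lemma counit_arr:
  assumes p: "p \<in> hom C A B" and s: "s \<in> hom C B A"
  shows "copair C s (ker C p) \<in> hom C (coprod_obj C B (ker_obj C p)) A"
    "copair C s (ker C p) \<cdot> inl C B (ker_obj C p) = s"
    "copair C s (ker C p) \<cdot> inr C B (ker_obj C p) = ker C p"
  using copair[OF s ker_in[OF p]] by auto

text \<open>\<open>p\<close> after \<open>[s, ker p]\<close> is \<open>[1,0]\<close>, because
  \<open>p s = 1\<close> and \<open>p (ker p) = 0\<close>.\<close>

lemma counit_hom:
  assumes X: "(A, p, s) \<in> points C B"
  shows "plus_ker_counit C B (A, p, s) \<in>
    hom (Pt C B) (plus_point C B (ker_obj C p)) (A, p, s)"
proof -
  have p: "p \<in> hom C A B" and s: "s \<in> hom C B A" and ps: "p \<cdot> s = Ident C B"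
    using X by (auto simp: points_def)
  have K: "ker_obj C p \<in> Obj C" using hom_obj[OF ker_in[OF p]] by simp
  note e = counit_arr[OF p s]
  have "p \<cdot> copair C s (ker C p) = aug (ker_obj C p)"
    by (rule coprod_cancel[OF B K Comp_in[OF e(1) p] aug(1)[OF K]])
      (simp_all only: Comp_assoc[OF inl_in_B[OF K] e(1) p, symmetric]
        Comp_assoc[OF inr_in_B[OF K] e(1) p, symmetric] e aug[OF K] ps comp_ker[OF p])
  then show ?thesis
    using e X plus_point_in[OF K] by (simp add: plus_ker_counit_def plus_point_def point_hom_iff)
qed

text \<open>Here \<open>K\<close> is the action of the monad on \<open>f\<close>, the restriction of
  \<open>1 + f\<close> to the kernels of the two arrows \<open>[1,0]\<close>.\<close>

lemma ker_plus_arr: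
  assumes f: "f \<in> hom C X Y"
  defines "K \<equiv> FA (ker_functor C B) (FA (plus_functor C B) f)"
  shows "K \<in> hom C (ker_obj C (aug X)) (ker_obj C (aug Y))"
    and "ker C (aug Y) \<cdot> K = plus f \<cdot> ker C (aug X)"
proof -
  have XY: "X \<in> Obj C" "Y \<in> Obj C" "Dom C f = X" "Cod C f = Y"
    using f hom_obj[OF f] by (auto simp: hom_iff)
  have "aug Y \<cdot> plus f = aug X"
    using plus_hom[OF f] by (auto simp: plus_point_def plus_functor_def point_hom_iff)
  from ker_functor_arr[OF aug(1)[OF XY(1)] aug(1)[OF XY(2)] plus(1)[OF f] this]
  show "K \<in> hom C (ker_obj C (aug X)) (ker_obj C (aug Y))"
    and "ker C (aug Y) \<cdot> K = plus f \<cdot> ker C (aug X)"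
    unfolding K_def using XY by (auto simp: plus_functor_def plus_point_def)
qed

lemma unit_natural:
  assumes f: "f \<in> hom C X Y"
  shows "plus_ker_unit C B Y \<cdot> f =
    FA (ker_functor C B) (FA (plus_functor C B) f) \<cdot> plus_ker_unit C B X"
proof -
  have X: "X \<in> Obj C" and Y: "Y \<in> Obj C" using hom_obj[OF f] by auto
  note K = ker_plus_arr[OF f] and kX = ker_in[OF aug(1)[OF X]] and kY = ker_in[OF aug(1)[OF Y]]
  show ?thesis
    by (rule ker_cancel[OF aug(1)[OF Y] Comp_in[OF f unit(1)[OF Y]] Comp_in[OF unit(1)[OF X] K(1)]])
      (simp only: Comp_assoc[OF f unit(1)[OF Y] kY] Comp_assoc[OF unit(1)[OF X] K(1) kY] K(2)
        Comp_assoc[OF unit(1)[OF X] kX plus(1)[OF f], symmetric] unit(2)[OF X] unit(2)[OF Y]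
        plus(3)[OF f])
qed

text \<open>On the injection of \<open>B\<close> the square reduces to \<open>f s = s'\<close>, on
  that of the kernel to the defining square of the induced kernel arrow.\<close>

lemma counit_natural:
  assumes g: "g \<in> hom (Pt C B) P Q"
  shows "plus_ker_counit C B Q \<cdot>\<^bsub>Pt C B\<^esub> FA (plus_functor C B) (FA (ker_functor C B) g) =
    g \<cdot>\<^bsub>Pt C B\<^esub> plus_ker_counit C B P"
proof -
  obtain A p s A' p' s' where PQ: "P = (A, p, s)" "Q = (A', p', s')" by (cases P, cases Q)
  obtain f where g_eq: "g = ((A, p, s), f, (A', p', s'))" and p: "p \<in> hom C A B"
    and p': "p' \<in> hom C A' B" and s: "s \<in> hom C B A" and s': "s' \<in> hom C B A'"
    and f: "f \<in> hom C A A'" and pf: "p' \<cdot> f = p" and fs: "f \<cdot> s = s'"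
    using g unfolding PQ point_hom_iff by (auto simp: points_def)
  let ?K = "FA (ker_functor C B) g"
  have K: "ker_obj C p \<in> Obj C" "ker_obj C p' \<in> Obj C"
    using hom_obj[OF ker_in[OF p]] hom_obj[OF ker_in[OF p']] by auto
  note Kf = ker_functor_arr[OF p p' f pf, of s s', folded g_eq]
  note e = counit_arr[OF p s] and e' = counit_arr[OF p' s']
  have "copair C s' (ker C p') \<cdot> plus ?K = f \<cdot> copair C s (ker C p)"
    by (rule coprod_cancel[OF B K(1) Comp_in[OF plus(1)[OF Kf(1)] e'(1)] Comp_in[OF e(1) f]])
      (simp_all only: Comp_assoc[OF inl_in_B[OF K(1)] plus(1)[OF Kf(1)] e'(1), symmetric]
        Comp_assoc[OF inr_in_B[OF K(1)] plus(1)[OF Kf(1)] e'(1), symmetric]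
        Comp_assoc[OF inl_in_B[OF K(1)] e(1) f, symmetric]
        Comp_assoc[OF inr_in_B[OF K(1)] e(1) f, symmetric]
        plus[OF Kf(1)] Comp_assoc[OF Kf(1) inr_in_B[OF K(2)] e'(1)] e e' Kf(2) fs)
  moreover have "Dom C ?K = ker_obj C p" using Kf(1) by (simp add: hom_iff)
  ultimately show ?thesis
    unfolding PQ by (simp add: g_eq plus_ker_counit_def plus_functor_def Pt_simps)
qed

text \<open>On the second injection the composite is the kernel inclusion after the unit, which is
  that injection again by the definition of the unit.\<close>

lemma triangle_left:
  assumes X: "X \<in> Obj C"
  shows "plus_ker_counit C B (plus_point C B X) \<cdot>\<^bsub>Pt C B\<^esub>
    FA (plus_functor C B) (plus_ker_unit C B X) = Ident (Pt C B) (plus_point C B X)"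
proof -
  note u = unit[OF X] and e = counit_arr[OF aug(1)[OF X] inl_in_B[OF X]]
  let ?u = "plus_ker_unit C B X"
  have K: "ker_obj C (aug X) \<in> Obj C" and CX: "coprod_obj C B X \<in> Obj C"
    using hom_obj[OF ker_in[OF aug(1)[OF X]]] hom_obj[OF inl_in_B[OF X]] by auto
  have "copair C (inl C B X) (ker C (aug X)) \<cdot> plus ?u = Ident C (coprod_obj C B X)"
    by (rule coprod_cancel[OF B X Comp_in[OF plus(1)[OF u(1)] e(1)] Ident_in[OF CX]])
      (simp_all only: Comp_assoc[OF inl_in_B[OF X] plus(1)[OF u(1)] e(1), symmetric]
        Comp_assoc[OF inr_in_B[OF X] plus(1)[OF u(1)] e(1), symmetric] plus[OF u(1)]
        Comp_assoc[OF u(1) inr_in_B[OF K] e(1)] e u(2)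
        Ident_left[OF inl_in_B[OF X]] Ident_left[OF inr_in_B[OF X]])
  moreover have "Dom C ?u = X" using u by (simp add: hom_iff)
  ultimately show ?thesis
    by (simp add: plus_point_def plus_ker_counit_def plus_functor_def Pt_simps)
qed

text \<open>After the monic \<open>ker p\<close> the composite becomes \<open>[s, ker p]\<close>
  after the second injection, which is \<open>ker p\<close>.\<close>

lemma triangle_right:
  assumes P: "(A, p, s) \<in> points C B"
  shows "FA (ker_functor C B) (plus_ker_counit C B (A, p, s)) \<cdot> plus_ker_unit C B (ker_obj C p) =
    Ident C (ker_obj C p)"
proof -
  have p: "p \<in> hom C A B" and s: "s \<in> hom C B A" using P by (auto simp: points_def)
  have K: "ker_obj C p \<in> Obj C" using hom_obj[OF ker_in[OF p]] by simp
  note e = counit_arr[OF p s] and u = unit[OF K] and k = ker_in[OF aug(1)[OF K]]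
  have "p \<cdot> copair C s (ker C p) = aug (ker_obj C p)"
    using counit_hom[OF P] by (auto simp: plus_ker_counit_def plus_point_def point_hom_iff)
  note Ke = ker_functor_arr[OF aug(1)[OF K] p e(1) this, of "inl C B (ker_obj C p)" s]
  have "FA (ker_functor C B) ((coprod_obj C B (ker_obj C p), aug (ker_obj C p), inl C B (ker_obj C p)),
      copair C s (ker C p), (A, p, s)) \<cdot> plus_ker_unit C B (ker_obj C p) = Ident C (ker_obj C p)"
    by (rule ker_cancel[OF p Comp_in[OF u(1) Ke(1)] Ident_in[OF K]])
      (simp only: Comp_assoc[OF u(1) Ke(1) ker_in[OF p]] Ke(2) Comp_assoc[OF u(1) k e(1), symmetric]
        u(2) e(3) Ident_right[OF ker_in[OF p]])
  then show ?thesis by (simp add: plus_ker_counit_def plus_point_def)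
qed

lemma adjunction_plus_ker:
  "adjunction C (Pt C B) (plus_functor C B) (ker_functor C B)
    (plus_ker_unit C B) (plus_ker_counit C B)"
proof -
  interpret Pt: category "Pt C B" by (rule category_Pt)
  have FO: "FO (plus_functor C B) X = plus_point C B X"
    "FO (ker_functor C B) (A, p, s) = ker_obj C p" for X A p s
    by (simp_all add: plus_functor_def ker_functor_def)
  show ?thesis
  proof
    fix X assume X: "X \<in> Obj C"
    show "plus_ker_unit C B X \<in> hom C X (FO (ker_functor C B) (FO (plus_functor C B) X))"
      using unit(1)[OF X] by (simp only: ker_plus_obj)
    show "plus_ker_counit C B (FO (plus_functor C B) X) \<cdot>\<^bsub>Pt C B\<^esub>
        FA (plus_functor C B) (plus_ker_unit C B X) = Ident (Pt C B) (FO (plus_functor C B) X)"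
      unfolding FO by (rule triangle_left[OF X])
  next
    fix P assume "P \<in> Obj (Pt C B)"
    then obtain A p s where P: "P = (A, p, s)" "(A, p, s) \<in> points C B"
      by (cases P) (auto simp: Pt_simps)
    show "plus_ker_counit C B P \<in> hom (Pt C B) (FO (plus_functor C B) (FO (ker_functor C B) P)) P"
      unfolding P FO by (rule counit_hom[OF P(2)])
    show "FA (ker_functor C B) (plus_ker_counit C B P) \<cdot> plus_ker_unit C B (FO (ker_functor C B) P) =
        Ident C (FO (ker_functor C B) P)"
      unfolding P FO by (rule triangle_right[OF P(2)])
  qed (fact is_functor_plus is_functor_ker unit_natural counit_natural)+
qed

end

text \<open>A join is determined only up to isomorphism of representing monomorphisms, so the
  conclusion asserts that one exists and that every representative is characteristic.\<close>

theorem proposition3p2: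
  fixes C :: "('o, 'a) cat" and G :: 'o and h k :: 'a
  assumes "semi_abelian C"
    and "\<forall>B\<in>Obj C. preserves_jointly_strongly_epic (Pt C B) C (ker_functor C B)"
    and "G \<in> Obj C"
    and "is_characteristic C G h"
    and "is_characteristic C G k"
  shows "(\<exists>j. is_join C G h k j) \<and> (\<forall>j. is_join C G h k j \<longrightarrow> is_characteristic C G j)"
proof -
  have cat: "category C" and pt: "pointed C" and cp: "has_binary_coproducts C"
    and reg: "regular C" and lim: "has_finite_limits C"
    using assms(1) by (auto simp: semi_abelian_def barr_exact_def regular_def)
  interpret regular_category C
    using cat reg lim
    by (simp add: regular_category_def regular_category_axioms_def
        finitely_complete_category_def finitely_complete_category_axioms_def)
  interpret pointed_category_with_coproducts C
    using pt cp by unfold_locales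
  have hk: "is_subobject C G h" "is_subobject C G k"
    using assms(4,5) by (auto simp: is_characteristic_def)
  obtain j where "is_join C G h k j" by (rule join_exists[OF cp hk])
  moreover have "is_characteristic C G j" if j: "is_join C G h k j" for j
    unfolding is_characteristic_def
  proof (intro conjI ballI allI impI)
    show "is_subobject C G j" using j by (simp add: is_join_def)
    fix B \<xi> assume B: "B \<in> Obj C" and \<xi>: "is_action C B G \<xi>"
    interpret coproduct_kernel_adjunction C B using B by unfold_locales
    interpret A: adjunction C "Pt C B" "plus_functor C B" "ker_functor C B"
      "plus_ker_unit C B" "plus_ker_counit C B"
      by (rule adjunction_plus_ker)
    obtain a where a: "is_action C B (Dom C h) a" "h \<cdot>\<^bsub>C\<^esub> a = \<xi> \<cdot>\<^bsub>C\<^esub> FA (Endo (flat_monad C B)) h"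
      using assms(4) B \<xi> unfolding is_characteristic_def by blast
    obtain b where b: "is_action C B (Dom C k) b" "k \<cdot>\<^bsub>C\<^esub> b = \<xi> \<cdot>\<^bsub>C\<^esub> FA (Endo (flat_monad C B)) k"
      using assms(5) B \<xi> unfolding is_characteristic_def by blast
    have pres: "preserves_jointly_strongly_epic (Pt C B) C (ker_functor C B)"
      using assms(2) B by blast
    show "\<exists>!c. is_action C B (Dom C j) c \<and> j \<cdot>\<^bsub>C\<^esub> c = \<xi> \<cdot>\<^bsub>C\<^esub> FA (Endo (flat_monad C B)) j"
      \<comment> \<open>\<open>flat_monad\<close> is by definition the monad of the interpreted
        adjunction, so unfolding exposes the goal as an instance of the abstract statement.\<close>
      unfolding is_action_def flat_monad_def
      by (rule A.join_subalgebra[OF pres _ j, of \<xi> a b])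
        (use a b \<xi> hk in \<open>auto simp: is_action_def is_algebra_def flat_monad_def
          is_subobject_def is_mono_def\<close>)
  qed
  ultimately show ?thesis by blast
qed

end
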